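(* Let $\mathbf{F}$ be a field of characteristic $2$ and $m\ge1$. For each unordered pair $\{A,B\}$ of (not necessarily distinct) elements of $\{0,1\}^m$ with $|A|,|B|\ge2$, choose one of the two orderings $(A,B)$ or $(B,A)$ and take the corresponding type II relation. Then $\ker(\pi)$ is minimally generated, as an ideal of $Q$, by (i) the $2^m-\binom{m}{2}-m-1$ type I relations $\rho_A$ for $A\in\{0,1\}^m$ with $|A|\ge3$, together with (ii) the $\binom{2^m-m}{2}$ chosen type II relations, one for each unordered product of two (possibly equal) of the $2^m-m-1$ elements $\mathrm{Tr}(A)$, $|A|\ge2$.
   Context: Let $S=\mathbf{F}[x_1,y_1,\dots,x_m,y_m]$ with the $\mathbf{F}$-algebra automorphism $\sigma(x_i)=x_i$, $\sigma(y_i)=y_i+x_i$ of order 2, and let $S^{C_2}$ be the ring of $\sigma$-invariants. For $A=(a_1,\dots,a_m)\in\mathbb{N}^m$ write $x^A=\prod_s x_s^{a_s}$, $y^A=\prod_s y_s^{a_s}$, $N^A=\prod_s N_s^{a_s}$, $|A|=\sum_s a_s$. $A\le B$ means componentwise $\le$; $L<A$ means $L\le A$, $L\ne A$; sums/differences are componentwise. Elements of $\{0,1\}^m$ are identified with subsets of $\{1,\dots,m\}$; $\cap,\setminus$ are set operations. $\Delta_s$ has $1$ in position $s$ and $0$ elsewhere. For $A\in\{0,1\}^m$, $\mathrm{tr}(A)=y^A+\prod_s(y_s+x_s)^{a_s}$. Let $R=\mathbf{F}[x_1,\dots,x_m,N_1,\dots,N_m]$ (polynomial ring in $2m$ indeterminates),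 $Q=R[\mathrm{Tr}(A):A\in\{0,1\}^m,|A|\ge2]$ (polynomial ring), and $\pi:Q\to S^{C_2}$ the $\mathbf{F}$-algebra homomorphism with $\pi(x_i)=x_i$, $\pi(N_i)=y_i^2+x_iy_i$, $\pi(\mathrm{Tr}(A))=\mathrm{tr}(A)$ (it is known to be surjective). Convention: $\mathrm{Tr}(0)=0$ and $\mathrm{Tr}(\Delta_s)=x_s$ in $Q$. The type I relation for $A\in\{0,1\}^m$ with $|A|\ge3$ is $\rho_A=\sum_{0<L<A}x^{A-L}\mathrm{Tr}(L)\in Q$. For an ordered pair $(A,B)$ with $|A|,|B|\ge2$, with $I=A\cap B$, $J=A\setminus B$, $K=B\setminus A$, the type II relation is $\mathrm{Tr}(A)\mathrm{Tr}(B)+\sum_{L<I}x^{I-L}N^L\mathrm{Tr}(I-L+J+K)+N^I\sum_{L<J}x^{J-L}\mathrm{Tr}(L+K)\in Q$. Both types lie in $\ker(\pi)$. $Q$ is graded by $\deg x_i=1$, $\deg N_i=2$, $\deg\mathrm{Tr}(A)=|A|$; $\ker\pi$ is homogeneous, and a generating set is minimal if no proper subset generates. *)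

theory Defs
  imports "HOL-Library.Poly_Mapping"
begin

type_synonym ('v, 'k) mpoly = "('v \<Rightarrow>\<^sub>0 nat) \<Rightarrow>\<^sub>0 'k"

definition Var :: "'v \<Rightarrow> ('v, 'k::comm_ring_1) mpoly" where
  "Var v = Poly_Mapping.single (Poly_Mapping.single v 1) 1"

definition Const :: "'k::comm_ring_1 \<Rightarrow> ('v, 'k) mpoly" where
  "Const c = Poly_Mapping.single 0 c"

definition meval :: "('v \<Rightarrow> 'r::comm_ring_1) \<Rightarrow> ('v \<Rightarrow>\<^sub>0 nat) \<Rightarrow> 'r" where
  "meval f mn = (\<Prod>v\<in>Poly_Mapping.keys mn. f v ^ Poly_Mapping.lookup mn v)"

definition peval :: "('v \<Rightarrow> 'r::comm_ring_1) \<Rightarrow> ('k::comm_ring_1 \<Rightarrow> 'r) \<Rightarrow> ('v, 'k) mpoly \<Rightarrow> 'r" where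
  "peval f c p = (\<Sum>mn\<in>Poly_Mapping.keys p. c (Poly_Mapping.lookup p mn) * meval f mn)"

datatype svar = Sx nat | Sy nat

datatype qvar = Qx nat | QN nat | QT "nat set"

text \<open>Subsets A of {0..<m} (identified with {0,1}^m) with |A| >= k.\<close>
definition subsets_ge :: "nat \<Rightarrow> nat \<Rightarrow> nat set set" where
  "subsets_ge m k = {A. A \<subseteq> {..<m} \<and> card A \<ge> k}"

definition qvars :: "nat \<Rightarrow> qvar set" where
  "qvars m = Qx ` {..<m} \<union> QN ` {..<m} \<union> QT ` subsets_ge m 2"

definition Qring :: "nat \<Rightarrow> (qvar, 'k::comm_ring_1) mpoly set" where
  "Qring m = {p. \<forall>mn\<in>Poly_Mapping.keys p. Poly_Mapping.keys mn \<subseteq> qvars m}"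

definition trS :: "nat set \<Rightarrow> (svar, 'k::comm_ring_1) mpoly" where
  "trS A = (\<Prod>s\<in>A. Var (Sy s)) + (\<Prod>s\<in>A. Var (Sy s) + Var (Sx s))"

definition pi_img :: "qvar \<Rightarrow> (svar, 'k::comm_ring_1) mpoly" where
  "pi_img v = (case v of
      Qx i \<Rightarrow> Var (Sx i)
    | QN i \<Rightarrow> Var (Sy i) ^ 2 + Var (Sx i) * Var (Sy i)
    | QT A \<Rightarrow> trS A)"

definition piQ :: "(qvar, 'k::comm_ring_1) mpoly \<Rightarrow> (svar, 'k) mpoly" where
  "piQ = peval pi_img Const"

definition kerPi :: "nat \<Rightarrow> (qvar, 'k::comm_ring_1) mpoly set" where
  "kerPi m = {p \<in> Qring m. piQ p = 0}"

definition Tr :: "nat set \<Rightarrow> (qvar, 'k::comm_ring_1) mpoly" where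
  "Tr L = (if L = {} then 0 else if card L = 1 then Var (Qx (the_elem L)) else Var (QT L))"

definition xpow :: "nat set \<Rightarrow> (qvar, 'k::comm_ring_1) mpoly" where
  "xpow A = (\<Prod>s\<in>A. Var (Qx s))"

definition Npow :: "nat set \<Rightarrow> (qvar, 'k::comm_ring_1) mpoly" where
  "Npow A = (\<Prod>s\<in>A. Var (QN s))"

definition rho :: "nat set \<Rightarrow> (qvar, 'k::comm_ring_1) mpoly" where
  "rho A = (\<Sum>L\<in>{L. L \<subset> A \<and> L \<noteq> {}}. xpow (A - L) * Tr L)"

definition typeII :: "nat set \<Rightarrow> nat set \<Rightarrow> (qvar, 'k::comm_ring_1) mpoly" where
  "typeII A B = (let I = A \<inter> B; J = A - B; K = B - A in
     Tr A * Tr B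
     + (\<Sum>L\<in>{L. L \<subset> I}. xpow (I - L) * Npow L * Tr ((I - L) \<union> J \<union> K))
     + Npow I * (\<Sum>L\<in>{L. L \<subset> J}. xpow (J - L) * Tr (L \<union> K)))"

definition gen_ideal :: "'a::comm_ring_1 set \<Rightarrow> 'a set \<Rightarrow> 'a set" where
  "gen_ideal R G = {(\<Sum>g\<in>F. c g * g) | F c. finite F \<and> F \<subseteq> G \<and> (\<forall>g\<in>F. c g \<in> R)}"

definition typeI_rels :: "nat \<Rightarrow> (qvar, 'k::comm_ring_1) mpoly set" where
  "typeI_rels m = rho ` subsets_ge m 3"

definition ordering_choice :: "nat \<Rightarrow> (nat set \<Rightarrow> nat set \<Rightarrow> nat set \<times> nat set) \<Rightarrow> bool" where
  "ordering_choice m ch \<longleftrightarrow> (\<forall>A\<in>subsets_ge m 2. \<forall>B\<in>subsets_ge m 2.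
      (ch A B = (A, B) \<or> ch A B = (B, A)) \<and> ch A B = ch B A)"

definition typeII_rels :: "nat \<Rightarrow> (nat set \<Rightarrow> nat set \<Rightarrow> nat set \<times> nat set) \<Rightarrow> (qvar, 'k::comm_ring_1) mpoly set" where
  "typeII_rels m ch = {case_prod typeII (ch A B) | A B. A \<in> subsets_ge m 2 \<and> B \<in> subsets_ge m 2}"

end

(*
  Modulo the type II relations every element of Q is an R-linear combination of 1 and the Tr(B), and the
  type I relation of {i} + B with i < min B rewrites x_i Tr(B) in terms of traces of smaller sets or of
  sets of the same size with a smaller minimum. What remains is spanned by the monomials in x and N and
  by the x^a N^b Tr(B) with a supported on {i. i >= min B}. For the weights w(x_i) = m - i, w(y_i) = m + 1,
  the image of such a monomial under pi has a unique monomial of largest weight, namely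
  x^a y^(2b) x_(min B) y^(B - min B), and these are pairwise distinct. So pi is injective on the span of
  the remaining monomials, and the relations generate its kernel. Minimality is read off from the
  coefficients of the relations at monomials with exactly two factors.
*)

theory Submission
  imports Defs
begin

text \<open>The shape of the leading monomial comes from a cancellation: the product of all
  \<open>y_s\<close> over B occurs in both halves of the trace of B and vanishes in characteristic
  2. The heaviest surviving term has exactly one \<open>y_s\<close> replaced by \<open>x_s\<close>.
  Such a replacement at s lowers the weight by s + 1, so it is cheapest at the least index of B. The
  type I relations are oriented by the same minimum, and the support condition that the rewriting
  leaves behind is what makes the leading monomial decodable: the parities of the y-exponents give B
  without its minimum, and the minimum is the least index with a positive x-exponent. Existence of a
  normal remainder together with injectivity on normal polynomials does the work of a confluence
  check. For minimality the obstacle is that a type II relation may contain the very monomial by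
  which a type I relation is recognised. The constant terms of the type II coefficients are
  therefore shown to vanish before the type I relations are separated.\<close>

abbreviation "lookup \<equiv> Poly_Mapping.lookup"
abbreviation "keys \<equiv> Poly_Mapping.keys"
abbreviation "single \<equiv> Poly_Mapping.single"

section \<open>Polynomials as finitely supported functions\<close>

lemma poly_mapping_sum_single:
  fixes p :: "'a \<Rightarrow>\<^sub>0 'b::comm_monoid_add"
  shows "p = (\<Sum>a\<in>keys p. single a (lookup p a))"
proof (rule poly_mapping_eqI)
  fix k
  have "lookup (\<Sum>a\<in>keys p. single a (lookup p a)) k = (\<Sum>a\<in>keys p. if a = k then lookup p a else 0)"
    by (simp add: lookup_sum lookup_single when_def)
  also have "\<dots> = lookup p k"
    by (simp add: sum.delta in_keys_iff)
  finally show "lookup p k = lookup (\<Sum>a\<in>keys p. single a (lookup p a)) k" ..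
qed

lemma poly_mapping_add_induct [case_names zero single add]:
  fixes p :: "'a \<Rightarrow>\<^sub>0 'b::comm_monoid_add"
  assumes "P 0" "\<And>a. a \<in> keys p \<Longrightarrow> P (single a (lookup p a))" "\<And>p q. P p \<Longrightarrow> P q \<Longrightarrow> P (p + q)"
  shows "P p"
proof -
  have "P (\<Sum>a\<in>A. single a (lookup p a))" if "finite A" "A \<subseteq> keys p" for A
    using that by (induction rule: finite_induct) (auto intro: assms)
  then show ?thesis
    using poly_mapping_sum_single[of p] by (metis finite_keys order_refl)
qed

lemma single_prod:
  "finite I \<Longrightarrow> (\<Prod>i\<in>I. single (t i) (1::'k::comm_ring_1)) = single (\<Sum>i\<in>I. t i) 1"
  by (induction rule: finite_induct) (auto simp: mult_single)

lemma lookup_Const_mult: "lookup (single 0 a * h) n = a * lookup (h::('v,'k::comm_ring_1) mpoly) n"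
  unfolding mult_map_scale_conv_mult[symmetric] by (simp add: map.rep_eq when_def)

lemma mpoly_add_self:
  assumes "CHAR('k::comm_ring_1) = 2"
  shows "(p::('v,'k) mpoly) + p = 0"
proof (rule poly_mapping_eqI)
  fix k
  have "(1 + 1 :: 'k) = 0"
    using assms of_nat_CHAR[where 'a = 'k] by simp
  then have "lookup p k + lookup p k = 0"
    by (metis distrib_right mult_1 mult_zero_left)
  then show "lookup (p + p) k = lookup 0 k"
    by (simp only: lookup_add lookup_zero)
qed

lemma in_keys_multE:
  assumes "n \<in> keys (p * q)"
  obtains a b where "n = a + b" "a \<in> keys p" "b \<in> keys q"
  using assms keys_mult[of p q] by blast

section \<open>The evaluation homomorphism\<close>

lemma meval_superset:
  assumes "finite S" "keys n \<subseteq> S"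
  shows "meval f n = (\<Prod>v\<in>S. f v ^ lookup n v)"
  unfolding meval_def using assms by (intro prod.mono_neutral_left) (auto simp: in_keys_iff)

lemma meval_0 [simp]: "meval f 0 = 1"
  by (simp add: meval_def)

lemma meval_add: "meval f (a + b) = meval f a * meval f b"
proof -
  let ?S = "keys a \<union> keys b"
  have "meval f (a + b) = (\<Prod>v\<in>?S. f v ^ lookup (a + b) v)"
    by (rule meval_superset) (auto simp: keys_add)
  moreover have "meval f a = (\<Prod>v\<in>?S. f v ^ lookup a v)" "meval f b = (\<Prod>v\<in>?S. f v ^ lookup b v)"
    by (auto intro!: meval_superset)
  ultimately show ?thesis
    by (simp add: lookup_add power_add prod.distrib)
qed

lemma meval_single [simp]: "meval f (single v k) = f v ^ k"
  by (cases "k = 0") (auto simp: meval_def)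

lemma Const_0 [simp]: "Const 0 = 0"
  by (simp add: Const_def)

lemma Const_1 [simp]: "Const 1 = 1"
  by (simp add: Const_def)

lemma Const_add: "Const (a + b) = Const a + Const b"
  by (simp add: Const_def single_add)

lemma Const_mult: "Const (a * b) = Const a * Const b"
  by (simp add: Const_def mult_single)

lemma peval_superset:
  assumes "finite S" "keys p \<subseteq> S"
  shows "peval f Const p = (\<Sum>a\<in>S. Const (lookup p a) * meval f a)"
  unfolding peval_def using assms by (intro sum.mono_neutral_left) (auto simp: in_keys_iff)

lemma peval_0 [simp]: "peval f c 0 = 0"
  by (simp add: peval_def)

lemma peval_single: "peval f Const (single a c) = Const c * meval f a"
  by (cases "c = 0") (auto simp: peval_def)

lemma peval_add: "peval f Const (p + q) = peval f Const p + peval f Const q"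
proof -
  let ?S = "keys p \<union> keys q"
  have "peval f Const (p + q) = (\<Sum>a\<in>?S. Const (lookup (p + q) a) * meval f a)"
    by (rule peval_superset) (auto simp: keys_add)
  moreover have "peval f Const p = (\<Sum>a\<in>?S. Const (lookup p a) * meval f a)"
    "peval f Const q = (\<Sum>a\<in>?S. Const (lookup q a) * meval f a)"
    by (auto intro!: peval_superset)
  ultimately show ?thesis
    by (simp add: lookup_add Const_add sum.distrib distrib_right)
qed

lemma peval_mult: "peval f Const (p * q) = peval f Const p * peval f Const q"
proof (induction p rule: poly_mapping_add_induct)
  case (single a)
  show ?case
  proof (induction q rule: poly_mapping_add_induct)
    case (single b)
    then show ?case
      by (simp add: mult_single peval_single meval_add Const_mult mult_ac)
  qed (auto simp: peval_add distrib_left)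
qed (auto simp: peval_add distrib_right)

lemma peval_1 [simp]: "peval f Const 1 = 1"
  using peval_single[of f 0 1] by simp

lemma peval_Var [simp]: "peval f Const (Var v) = f v"
  by (simp add: Var_def peval_single)

lemma peval_diff: "peval f Const (p - q) = peval f Const p - peval f Const q"
  using peval_add[of f "p - q" q] by (simp add: algebra_simps)

lemma peval_uminus: "peval f Const (- p) = - peval f Const p"
  using peval_diff[of f 0 p] by simp

lemma peval_sum: "peval f Const (\<Sum>i\<in>I. g i) = (\<Sum>i\<in>I. peval f Const (g i))"
  by (induction I rule: infinite_finite_induct) (auto simp: peval_add)

lemma peval_prod: "peval f Const (\<Prod>i\<in>I. g i) = (\<Prod>i\<in>I. peval f Const (g i))"
  by (induction I rule: infinite_finite_induct) (auto simp: peval_mult)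

lemma piQ_0 [simp]: "piQ 0 = 0"
  by (simp add: piQ_def)

lemmas piQ_add = peval_add[of pi_img, folded piQ_def]
lemmas piQ_mult = peval_mult[of pi_img, folded piQ_def]
lemmas piQ_diff = peval_diff[of pi_img, folded piQ_def]
lemmas piQ_sum = peval_sum[of pi_img, folded piQ_def]
lemmas piQ_prod = peval_prod[of pi_img, folded piQ_def]
lemmas piQ_Var [simp] = peval_Var[of pi_img, folded piQ_def]

section \<open>Weights and leading monomials\<close>

definition weight :: "('v \<Rightarrow> nat) \<Rightarrow> ('v \<Rightarrow>\<^sub>0 nat) \<Rightarrow> nat" where
  "weight w n = (\<Sum>v\<in>keys n. lookup n v * w v)"

lemma weight_superset:
  assumes "finite S" "keys n \<subseteq> S"
  shows "weight w n = (\<Sum>v\<in>S. lookup n v * w v)"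
  unfolding weight_def using assms by (intro sum.mono_neutral_left) (auto simp: in_keys_iff)

lemma weight_0 [simp]: "weight w 0 = 0"
  by (simp add: weight_def)

lemma weight_single [simp]: "weight w (single v k) = k * w v"
  by (cases "k = 0") (auto simp: weight_def)

lemma weight_add [simp]: "weight w (a + b) = weight w a + weight w b"
proof -
  let ?S = "keys a \<union> keys b"
  have "weight w (a + b) = (\<Sum>v\<in>?S. lookup (a + b) v * w v)"
    by (rule weight_superset) (auto simp: keys_add)
  moreover have "weight w a = (\<Sum>v\<in>?S. lookup a v * w v)" "weight w b = (\<Sum>v\<in>?S. lookup b v * w v)"
    by (auto intro!: weight_superset)
  ultimately show ?thesis
    by (simp add: lookup_add sum.distrib distrib_right)
qed

lemma weight_sum [simp]: "weight w (\<Sum>i\<in>I. f i) = (\<Sum>i\<in>I. weight w (f i))"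
  by (induction I rule: infinite_finite_induct) auto

lemma weight_pos:
  assumes "n \<noteq> 0" "\<And>v. w v > 0"
  shows "weight w n > 0"
proof -
  obtain v where v: "v \<in> keys n"
    using assms(1) by (metis all_not_in_conv keys_eq_empty)
  then have "0 < lookup n v * w v"
    using assms(2)[of v] by (simp add: in_keys_iff)
  also have "\<dots> \<le> weight w n"
    unfolding weight_def by (rule member_le_sum) (use v in auto)
  finally show ?thesis .
qed

text \<open>The monomial \<open>t\<close> has coefficient 1 in \<open>p\<close>, and every other monomial of \<open>p\<close> has smaller weight.\<close>

definition lead :: "('v \<Rightarrow> nat) \<Rightarrow> ('v, 'k::comm_ring_1) mpoly \<Rightarrow> ('v \<Rightarrow>\<^sub>0 nat) \<Rightarrow> bool" where
  "lead w p t \<longleftrightarrow> (\<forall>u\<in>keys (p - single t 1). weight w u < weight w t)"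

lemma lead_lookup:
  assumes "lead w p t"
  shows "lookup p t = 1"
proof -
  have "t \<notin> keys (p - single t 1)"
    using assms by (auto simp: lead_def)
  then show ?thesis
    by (simp add: in_keys_iff lookup_minus)
qed

lemma lead_less:
  assumes "lead w p t" "u \<in> keys p" "u \<noteq> t"
  shows "weight w u < weight w t"
proof -
  have "u \<in> keys (p - single t 1)"
    using assms by (simp add: in_keys_iff lookup_minus lookup_single)
  then show ?thesis
    using assms by (auto simp: lead_def)
qed

lemma lead_1 [simp]: "lead w 1 0"
  by (simp add: lead_def)

text \<open>Leading coefficients equal to 1 cannot cancel, even when the coefficient ring has zero
  divisors. In the splitting \<open>eq\<close> each summand has one factor lying strictly below its
  lead and another not above its lead.\<close>

lemma lead_mult:
  assumes "lead w p t" "lead w q u"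
  shows "lead w (p * q) (t + u)"
proof -
  have eq: "p * q - single (t + u) 1 = (p - single t 1) * q + single t 1 * (q - single u 1)"
    by (simp add: algebra_simps mult_single)
  have "weight w a < weight w (t + u)" if a: "a \<in> keys ((p - single t 1) * q)" for a
  proof -
    obtain b c where bc: "a = b + c" "b \<in> keys (p - single t 1)" "c \<in> keys q"
      using a by (rule in_keys_multE)
    have "weight w b < weight w t" "weight w c \<le> weight w u"
      using bc assms lead_less[OF assms(2), of c] by (auto simp: lead_def le_less)
    then show ?thesis
      by (simp add: bc)
  qed
  moreover have "weight w a < weight w (t + u)" if a: "a \<in> keys (single t 1 * (q - single u 1))" for a
  proof -
    obtain b c where bc: "a = b + c" "b \<in> keys (single t (1::'b))" "c \<in> keys (q - single u 1)"
      using a by (rule in_keys_multE)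
    then have "b = t"
      by (auto split: if_splits)
    then show ?thesis
      using bc assms by (auto simp: lead_def)
  qed
  ultimately show ?thesis
    unfolding lead_def eq
    using keys_add[of "(p - single t 1) * q" "single t 1 * (q - single u 1)"] by blast
qed

lemma lead_power: "lead w p t \<Longrightarrow> lead w (p ^ k) (\<Sum>i<k. t)"
  by (induction k) (auto simp: lead_mult mult.commute add.commute)

lemma lead_prod:
  "finite I \<Longrightarrow> (\<And>i. i \<in> I \<Longrightarrow> lead w (f i) (t i)) \<Longrightarrow> lead w (\<Prod>i\<in>I. f i) (\<Sum>i\<in>I. t i)"
  by (induction rule: finite_induct) (auto simp: lead_mult)

text \<open>The multiplicative extension of \<open>l\<close> to monomials. The inner sum is the
  multiple of \<open>l v\<close> by its exponent, in the shape that \<open>lead_power\<close>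
  produces.\<close>

definition lead_mon :: "('v \<Rightarrow> ('u \<Rightarrow>\<^sub>0 nat)) \<Rightarrow> ('v \<Rightarrow>\<^sub>0 nat) \<Rightarrow> ('u \<Rightarrow>\<^sub>0 nat)" where
  "lead_mon l n = (\<Sum>v\<in>keys n. \<Sum>i<lookup n v. l v)"

lemma lead_meval:
  assumes "\<And>v. v \<in> keys n \<Longrightarrow> lead w (f v) (l v)"
  shows "lead w (meval f n) (lead_mon l n)"
  unfolding meval_def lead_mon_def using assms by (intro lead_prod lead_power) auto

text \<open>Each exponent of the lead is linear in \<open>n\<close>, hence itself a weight;
  additivity then comes from \<open>weight_add\<close>.\<close>

lemma lookup_lead_mon: "lookup (lead_mon l n) u = weight (\<lambda>v. lookup (l v) u) n"
  by (simp add: lead_mon_def lookup_sum weight_def)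

text \<open>Among the leads pick a heaviest one. It differs from all other leads, and the remaining
  monomials of every image are strictly lighter than their own lead, so it occurs in one image only
  and its coefficient there survives. Ties in weight between different leads do no harm.\<close>

lemma eq_0_if_leads_distinct:
  fixes p :: "('v, 'k::comm_ring_1) mpoly"
  assumes lead: "\<And>n. n \<in> keys p \<Longrightarrow> lead w (meval f n) (t n)"
    and inj: "inj_on t (keys p)"
    and zero: "peval f Const p = 0"
  shows "p = 0"
proof (rule ccontr)
  assume "p \<noteq> 0"
  then have ne: "keys p \<noteq> {}"
    by simp
  define W where "W = Max ((\<lambda>n. weight w (t n)) ` keys p)"
  have "W \<in> (\<lambda>n. weight w (t n)) ` keys p"
    unfolding W_def using ne by (intro Max_in) auto
  then obtain n0 where n0: "n0 \<in> keys p" "weight w (t n0) = W"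
    by auto
  have le: "weight w (t n) \<le> W" if "n \<in> keys p" for n
    using that by (auto simp: W_def)
  have other: "lookup (meval f n) (t n0) = 0" if n: "n \<in> keys p" "n \<noteq> n0" for n
  proof (rule ccontr)
    assume "lookup (meval f n) (t n0) \<noteq> 0"
    then have "t n0 \<in> keys (meval f n)"
      by (simp add: in_keys_iff)
    moreover have "t n0 \<noteq> t n"
      using inj n n0 by (auto simp: inj_on_def)
    ultimately have "weight w (t n0) < weight w (t n)"
      using lead_less lead n by blast
    then show False
      using le[OF n(1)] n0 by simp
  qed
  have "0 = lookup (peval f Const p) (t n0)"
    by (simp add: zero)
  also have "\<dots> = (\<Sum>n\<in>keys p. lookup p n * lookup (meval f n) (t n0))"
    by (simp add: peval_def lookup_sum Const_def lookup_Const_mult)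
  also have "\<dots> = (\<Sum>n\<in>keys p. if n = n0 then lookup p n else 0)"
    using other lead_lookup[OF lead[OF n0(1)]] by (intro sum.cong) auto
  also have "\<dots> = lookup p n0"
    using n0 by (simp add: sum.delta)
  finally show False
    using n0 by (simp add: in_keys_iff)
qed

text \<open>With positive weights every nonconstant monomial of \<open>c\<close> pushes the terms of
  \<open>h\<close> strictly above the lowest weight, so only the constant term of \<open>c\<close>
  is seen there.\<close>

lemma lookup_mult_lowest_weight:
  fixes c h :: "('v, 'k::comm_ring_1) mpoly"
  assumes w: "\<And>v. w v > 0" and "\<And>u. u \<in> keys h \<Longrightarrow> weight w n \<le> weight w u"
  shows "lookup (c * h) n = lookup c 0 * lookup h n"
proof -
  define c' where "c' = c - single 0 (lookup c 0)"
  have eq: "c * h = single 0 (lookup c 0) * h + c' * h"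
    by (simp add: c'_def algebra_simps)
  have "n \<notin> keys (c' * h)"
  proof
    assume "n \<in> keys (c' * h)"
    then obtain a b where ab: "n = a + b" "a \<in> keys c'" "b \<in> keys h"
      by (rule in_keys_multE)
    have "a \<noteq> 0"
      using ab by (auto simp: c'_def in_keys_iff lookup_minus)
    then have "weight w a > 0"
      using w by (rule weight_pos)
    then show False
      using assms(2)[OF ab(3)] ab(1) by simp
  qed
  then show ?thesis
    by (simp add: eq lookup_add lookup_Const_mult in_keys_iff)
qed

section \<open>The relations lie in the kernel\<close>

lemma sum_psubsets:
  assumes "finite A"
  shows "(\<Sum>L\<in>{L. L \<subset> A}. f L) + f A = (\<Sum>L\<in>Pow A. (f L :: 'a::comm_monoid_add))"
proof -
  have "{L. L \<subset> A} = Pow A - {A}"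
    by auto
  then show ?thesis
    using assms sum.remove[of "Pow A" A f] by (simp add: add.commute)
qed

context
  fixes x u v :: "'a \<Rightarrow> 'r::comm_ring_1"
  assumes v: "\<And>s. u s + x s = v s" and u: "\<And>s. v s + x s = u s"
begin

text \<open>Here \<open>u\<close> and \<open>v\<close> play the roles of y and its conjugate y + x;
  adding x once more returns to y in characteristic 2. Expanding the products of
  \<open>u + x\<close> and of \<open>v + x\<close> over \<open>J\<close> shows that this sum
  conjugates the \<open>J\<close>-part of both products and leaves the \<open>K\<close>-part
  alone.\<close>

lemma sum_trace_union:
  assumes "finite J" "finite K" "J \<inter> K = {}"
  shows "(\<Sum>L\<in>Pow J. prod x (J - L) * (prod u (L \<union> K) + prod v (L \<union> K)))
    = prod v J * prod u K + prod u J * prod v K"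
proof -
  have "prod x (J - L) * (prod u (L \<union> K) + prod v (L \<union> K))
      = prod u L * prod x (J - L) * prod u K + prod v L * prod x (J - L) * prod v K"
    if L: "L \<in> Pow J" for L
  proof -
    have "finite L" "L \<inter> K = {}"
      using L assms by (auto intro: finite_subset)
    then show ?thesis
      using assms by (simp add: prod.union_disjoint algebra_simps)
  qed
  moreover have "(\<Sum>L\<in>Pow J. prod u L * prod x (J - L)) = prod v J"
    "(\<Sum>L\<in>Pow J. prod v L * prod x (J - L)) = prod u J"
    using prod_add[OF assms(1), of u x] prod_add[OF assms(1), of v x] by (simp_all add: u v)
  ultimately show ?thesis
    by (simp add: sum.distrib flip: sum_distrib_right)
qed

text \<open>For each s in \<open>I\<close> the choice is between the norm \<open>u s * v s\<close>
  and x times one conjugate. Since uv + ux = uu and uv + vx = vv, the full expansion yields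
  squares.\<close>

lemma sum_trace_square:
  assumes "finite I" "finite K" "I \<inter> K = {}"
  shows "(\<Sum>L\<in>Pow I. prod x (I - L) * (\<Prod>s\<in>L. u s * v s) * (prod u ((I - L) \<union> K) + prod v ((I - L) \<union> K)))
    = prod u I * prod u I * prod u K + prod v I * prod v I * prod v K"
proof -
  have "prod x (I - L) * (\<Prod>s\<in>L. u s * v s) * (prod u ((I - L) \<union> K) + prod v ((I - L) \<union> K))
      = (\<Prod>s\<in>L. u s * v s) * (\<Prod>s\<in>I-L. u s * x s) * prod u K
      + (\<Prod>s\<in>L. u s * v s) * (\<Prod>s\<in>I-L. v s * x s) * prod v K"
    if L: "L \<in> Pow I" for L
  proof -
    have "finite (I - L)" "(I - L) \<inter> K = {}"
      using L assms by (auto intro: finite_subset)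
    then show ?thesis
      using assms by (simp add: prod.union_disjoint prod.distrib algebra_simps)
  qed
  moreover have "u s * v s + u s * x s = u s * u s" "u s * v s + v s * x s = v s * v s" for s
    using u[of s] v[of s] by (metis distrib_left mult.commute)+
  then have "(\<Sum>L\<in>Pow I. (\<Prod>s\<in>L. u s * v s) * (\<Prod>s\<in>I-L. u s * x s)) = prod u I * prod u I"
    "(\<Sum>L\<in>Pow I. (\<Prod>s\<in>L. u s * v s) * (\<Prod>s\<in>I-L. v s * x s)) = prod v I * prod v I"
    using prod_add[OF assms(1), of "\<lambda>s. u s * v s" "\<lambda>s. u s * x s"]
      prod_add[OF assms(1), of "\<lambda>s. u s * v s" "\<lambda>s. v s * x s"]
    by (simp_all add: prod.distrib)
  ultimately show ?thesis
    by (simp add: sum.distrib flip: sum_distrib_right)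
qed

end

lemma Tr_empty [simp]: "Tr {} = 0"
  by (simp add: Tr_def)

lemma Tr_singleton [simp]: "Tr {s} = Var (Qx s)"
  by (simp add: Tr_def)

lemma Tr_ge2: "card A \<ge> 2 \<Longrightarrow> Tr A = Var (QT A)"
  by (auto simp: Tr_def)

lemma card_subsets_ge:
  assumes "A \<in> subsets_ge m k"
  shows "A \<subseteq> {..<m}" "finite A" "card A \<ge> k"
  using assms by (auto simp: subsets_ge_def intro: finite_subset)

text \<open>The empty set contributes nothing because \<open>Tr {} = 0\<close>; including it brings
  the sum into the form of \<open>sum_psubsets\<close>.\<close>

lemma rho_psubset_sum: "finite A \<Longrightarrow> rho A = (\<Sum>L\<in>{L. L \<subset> A}. xpow (A - L) * Tr L)"
  unfolding rho_def by (intro sum.mono_neutral_left) (auto intro: finite_subset[of _ "Pow A"])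

lemma trS_singleton:
  assumes "CHAR('k::comm_ring_1) = 2"
  shows "trS {s} = (Var (Sx s) :: (svar, 'k) mpoly)"
proof -
  have "trS {s} = (Var (Sy s) + Var (Sy s)) + (Var (Sx s) :: (svar, 'k) mpoly)"
    by (simp add: trS_def)
  then show ?thesis
    by (simp add: mpoly_add_self[OF assms])
qed

lemma piQ_Tr:
  assumes "CHAR('k::comm_ring_1) = 2"
  shows "piQ (Tr A) = (trS A :: (svar, 'k) mpoly)"
proof -
  consider "A = {}" | s where "A = {s}" | "A \<noteq> {}" "card A \<noteq> 1"
    by (meson card_1_singletonE)
  then show ?thesis
  proof cases
    case 1
    then show ?thesis
      by (simp add: trS_def mpoly_add_self[OF assms])
  next
    case 2
    then show ?thesis
      by (simp add: pi_img_def trS_singleton[OF assms])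
  next
    case 3
    then show ?thesis
      by (simp add: Tr_def pi_img_def)
  qed
qed

lemma piQ_xpow: "piQ (xpow A) = (\<Prod>s\<in>A. Var (Sx s))"
  by (simp add: xpow_def piQ_prod pi_img_def)

lemma piQ_Npow: "piQ (Npow A) = (\<Prod>s\<in>A. Var (Sy s) * (Var (Sy s) + Var (Sx s)))"
  by (simp add: Npow_def piQ_prod pi_img_def power2_eq_square algebra_simps)

lemma mpoly_add_add_self:
  assumes "CHAR('k::comm_ring_1) = 2"
  shows "p + q + q = (p :: ('v, 'k) mpoly)"
  by (simp only: add.assoc mpoly_add_self[OF assms] add_0_right)

text \<open>The sum lacks only its term at \<open>L = A\<close>, which is the trace of
  \<open>A\<close>. The completed sum is the trace with its two halves exchanged, so it equals the
  added term.\<close>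

lemma piQ_rho:
  assumes "CHAR('k::comm_ring_1) = 2" "finite A"
  shows "piQ (rho A) = (0 :: (svar, 'k) mpoly)"
proof -
  let ?f = "\<lambda>L. (\<Prod>s\<in>A-L. Var (Sx s)) * (trS L :: (svar, 'k) mpoly)"
  have "piQ (rho A) + ?f A = (\<Sum>L\<in>Pow A. ?f L)"
    unfolding sum_psubsets[OF assms(2), symmetric]
    by (simp add: rho_psubset_sum assms piQ_sum piQ_mult piQ_xpow piQ_Tr)
  also have "\<dots> = trS A"
    using sum_trace_union[of "\<lambda>s. Var (Sy s)" "\<lambda>s. Var (Sx s)"
        "\<lambda>s. Var (Sy s) + (Var (Sx s) :: (svar, 'k) mpoly)" A "{}",
        OF refl mpoly_add_add_self[OF assms(1)]] assms(2)
    by (simp add: trS_def add.commute)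
  finally show ?thesis
    by simp
qed

text \<open>Completing the two sums by \<open>L = I\<close> and \<open>L = J\<close> adds the same
  element twice, namely the norm over \<open>I\<close> times the trace of
  \<open>J \<union> K\<close>, which is 0 in characteristic 2. In the expansion of the product of
  two traces, the completed first sum gives the two terms without mixed conjugates, and the
  completed second sum, times the norm over \<open>I\<close>, gives the two mixed ones.\<close>

lemma piQ_typeII:
  assumes char2: "CHAR('k::comm_ring_1) = 2" and fin: "finite A" "finite B"
  shows "piQ (typeII A B) = (0 :: (svar, 'k) mpoly)"
proof -
  define I J K where "I = A \<inter> B" and "J = A - B" and "K = B - A"
  have finI: "finite I" "finite J" "finite K" "J \<inter> K = {}" "I \<inter> (J \<union> K) = {}" "I \<inter> J = {}" "I \<inter> K = {}"
    using fin by (auto simp: I_def J_def K_def)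
  have A: "A = I \<union> J" and B: "B = I \<union> K"
    by (auto simp: I_def J_def K_def)
  let ?x = "\<lambda>s. Var (Sx s) :: (svar, 'k) mpoly"
  let ?u = "\<lambda>s. Var (Sy s) :: (svar, 'k) mpoly"
  let ?v = "\<lambda>s. Var (Sy s) + Var (Sx s) :: (svar, 'k) mpoly"
  have uvx: "?u s + ?x s = ?v s" "?v s + ?x s = ?u s" for s
    by (rule refl, rule mpoly_add_add_self[OF char2])
  let ?f = "\<lambda>L. prod ?x (I - L) * (\<Prod>s\<in>L. ?u s * ?v s) * (trS ((I - L) \<union> J \<union> K) :: (svar, 'k) mpoly)"
  let ?g = "\<lambda>L. prod ?x (J - L) * (trS (L \<union> K) :: (svar, 'k) mpoly)"
  let ?N = "\<Prod>s\<in>I. ?u s * ?v s"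
  have "piQ (typeII A B) + (?f I + ?N * ?g J)
     = trS A * trS B + ((\<Sum>L\<in>{L. L \<subset> I}. ?f L) + ?f I) + ?N * ((\<Sum>L\<in>{L. L \<subset> J}. ?g L) + ?g J)"
    by (simp add: typeII_def Let_def piQ_add piQ_mult piQ_sum piQ_xpow piQ_Npow piQ_Tr[OF char2]
        flip: I_def J_def K_def) (simp add: algebra_simps)
  also have "\<dots> = trS A * trS B + (\<Sum>L\<in>Pow I. ?f L) + ?N * (\<Sum>L\<in>Pow J. ?g L)"
    by (simp only: sum_psubsets[OF finI(1), of ?f] sum_psubsets[OF finI(2), of ?g])
  also have "(\<Sum>L\<in>Pow I. ?f L) = prod ?u I * prod ?u I * prod ?u (J \<union> K) + prod ?v I * prod ?v I * prod ?v (J \<union> K)"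
    using sum_trace_square[of ?u ?x ?v I "J \<union> K"] finI uvx by (simp add: trS_def Un_assoc)
  also have "(\<Sum>L\<in>Pow J. ?g L) = prod ?v J * prod ?u K + prod ?u J * prod ?v K"
    using sum_trace_union[of ?u ?x ?v J K] finI uvx by (simp add: trS_def)
  also have "trS A * trS B + (prod ?u I * prod ?u I * prod ?u (J \<union> K) + prod ?v I * prod ?v I * prod ?v (J \<union> K))
      + ?N * (prod ?v J * prod ?u K + prod ?u J * prod ?v K) = trS A * trS B + trS A * trS B"
    unfolding trS_def A B
    by (simp only: prod.union_disjoint finI prod.distrib) (simp add: algebra_simps)
  also have "\<dots> = 0"
    by (rule mpoly_add_self[OF char2])
  also have "?f I + ?N * ?g J = 0"
    by (simp add: mpoly_add_self[OF char2])
  finally show ?thesis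
    by simp
qed

section \<open>The ring Q and its ideals\<close>

lemma Qring_0 [simp]: "0 \<in> Qring m"
  by (simp add: Qring_def)

lemma Qring_single: "keys n \<subseteq> qvars m \<Longrightarrow> single n c \<in> Qring m"
  by (simp add: Qring_def)

lemma Qring_1 [simp]: "1 \<in> Qring m"
  by (simp add: Qring_def)

lemma Qring_Var: "v \<in> qvars m \<Longrightarrow> Var v \<in> Qring m"
  by (simp add: Var_def Qring_single)

lemma Qring_add: "p \<in> Qring m \<Longrightarrow> q \<in> Qring m \<Longrightarrow> p + q \<in> Qring m"
  unfolding Qring_def using keys_add[of p q] by blast

lemma Qring_mult:
  assumes "p \<in> Qring m" "q \<in> Qring m"
  shows "p * q \<in> Qring m"
proof -
  have "keys n \<subseteq> qvars m" if n: "n \<in> keys (p * q)" for n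
  proof -
    obtain a b where "n = a + b" "a \<in> keys p" "b \<in> keys q"
      using n by (rule in_keys_multE)
    then show ?thesis
      using assms keys_add[of a b] unfolding Qring_def by blast
  qed
  then show ?thesis
    by (simp add: Qring_def)
qed

lemma Qring_sum: "(\<And>i. i \<in> I \<Longrightarrow> f i \<in> Qring m) \<Longrightarrow> (\<Sum>i\<in>I. f i) \<in> Qring m"
  by (induction I rule: infinite_finite_induct) (auto simp: Qring_add)

lemma Qring_prod: "(\<And>i. i \<in> I \<Longrightarrow> f i \<in> Qring m) \<Longrightarrow> (\<Prod>i\<in>I. f i) \<in> Qring m"
  by (induction I rule: infinite_finite_induct) (auto simp: Qring_mult)

lemma Qring_xpow: "A \<subseteq> {..<m} \<Longrightarrow> xpow A \<in> Qring m"
  unfolding xpow_def by (intro Qring_prod Qring_Var) (auto simp: qvars_def)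

lemma Qring_Npow: "A \<subseteq> {..<m} \<Longrightarrow> Npow A \<in> Qring m"
  unfolding Npow_def by (intro Qring_prod Qring_Var) (auto simp: qvars_def)

lemma Tr_cases:
  assumes "A \<subseteq> {..<m}"
  obtains "A = {}" | s where "A = {s}" "s < m" | "A \<in> subsets_ge m 2"
proof -
  have "finite A"
    using assms by (rule finite_subset) simp
  then consider "A = {}" | "card A = 1" | "card A \<ge> 2"
    by (cases "card A = 0"; cases "card A = 1") auto
  then show ?thesis
  proof cases
    case 2
    then show ?thesis
      using that(2) assms by (auto simp: card_1_singleton_iff)
  qed (use that assms in \<open>auto simp: subsets_ge_def\<close>)
qed

lemma Qring_Tr:
  assumes "A \<subseteq> {..<m}"
  shows "Tr A \<in> Qring m"
  using assms by (cases rule: Tr_cases) (auto simp: qvars_def Tr_ge2 card_subsets_ge intro!: Qring_Var)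

lemma Qring_rho: "A \<subseteq> {..<m} \<Longrightarrow> rho A \<in> Qring m"
  unfolding rho_def by (intro Qring_sum Qring_mult Qring_xpow Qring_Tr) auto

lemma Qring_typeII:
  assumes "A \<subseteq> {..<m}" "B \<subseteq> {..<m}"
  shows "typeII A B \<in> Qring m"
  unfolding typeII_def Let_def using assms
  by (intro Qring_add Qring_sum Qring_mult Qring_xpow Qring_Npow Qring_Tr) auto

text \<open>Coefficients extend by zero to all of \<open>G\<close>. With this common index set, sums
  and multiples of ideal elements can be formed coefficientwise.\<close>

lemma gen_ideal_finite:
  assumes "finite G"
  shows "gen_ideal (Qring m) G = {(\<Sum>g\<in>G. c g * g) | c. \<forall>g\<in>G. c g \<in> Qring m}"
proof (intro equalityI subsetI)
  fix p :: "(qvar, 'a) mpoly"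
  assume "p \<in> gen_ideal (Qring m) G"
  then obtain F c where F: "p = (\<Sum>g\<in>F. c g * g)" "finite F" "F \<subseteq> G" "\<forall>g\<in>F. c g \<in> Qring m"
    by (auto simp: gen_ideal_def)
  define c' where "c' g = (if g \<in> F then c g else 0)" for g
  have "p = (\<Sum>g\<in>G. c' g * g)"
    unfolding F(1) using F assms by (intro sum.mono_neutral_cong_left) (auto simp: c'_def)
  moreover have "\<forall>g\<in>G. c' g \<in> Qring m"
    using F by (auto simp: c'_def)
  ultimately show "p \<in> {(\<Sum>g\<in>G. c g * g) | c. \<forall>g\<in>G. c g \<in> Qring m}"
    by blast
next
  fix p :: "(qvar, 'a) mpoly"
  assume "p \<in> {(\<Sum>g\<in>G. c g * g) | c. \<forall>g\<in>G. c g \<in> Qring m}"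
  then show "p \<in> gen_ideal (Qring m) G"
    using assms unfolding gen_ideal_def by blast
qed

lemma gen_ideal_0: "0 \<in> gen_ideal (Qring m) G"
  unfolding gen_ideal_def by (intro CollectI exI[of _ "{}"]) auto

lemma gen_ideal_gen:
  assumes "g \<in> G"
  shows "g \<in> gen_ideal (Qring m) G"
  unfolding gen_ideal_def using assms by (intro CollectI exI[of _ "{g}"] exI[of _ "\<lambda>_. 1"]) auto

lemma gen_ideal_add:
  assumes "finite G" "p \<in> gen_ideal (Qring m) G" "q \<in> gen_ideal (Qring m) G"
  shows "p + q \<in> gen_ideal (Qring m) G"
proof -
  obtain c d where "p = (\<Sum>g\<in>G. c g * g)" "\<forall>g\<in>G. c g \<in> Qring m" "q = (\<Sum>g\<in>G. d g * g)" "\<forall>g\<in>G. d g \<in> Qring m"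
    using assms by (auto simp: gen_ideal_finite)
  then have "p + q = (\<Sum>g\<in>G. (c g + d g) * g)" "\<forall>g\<in>G. c g + d g \<in> Qring m"
    by (auto simp: sum.distrib distrib_right Qring_add)
  then show ?thesis
    unfolding gen_ideal_finite[OF assms(1)] by (intro CollectI exI conjI)
qed

lemma gen_ideal_mult:
  assumes "finite G" "q \<in> Qring m" "p \<in> gen_ideal (Qring m) G"
  shows "q * p \<in> gen_ideal (Qring m) G"
proof -
  obtain c where "p = (\<Sum>g\<in>G. c g * g)" "\<forall>g\<in>G. c g \<in> Qring m"
    using assms by (auto simp: gen_ideal_finite)
  then have "q * p = (\<Sum>g\<in>G. (q * c g) * g)" "\<forall>g\<in>G. q * c g \<in> Qring m"
    using assms(2) by (auto simp: sum_distrib_left mult.assoc Qring_mult)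
  then show ?thesis
    unfolding gen_ideal_finite[OF assms(1)] by (intro CollectI exI conjI)
qed

lemma finite_subsets_ge [simp]: "finite (subsets_ge m k)"
  by (rule finite_subset[of _ "Pow {..<m}"]) (auto simp: subsets_ge_def)

lemma finite_typeI_rels: "finite (typeI_rels m)"
  by (simp add: typeI_rels_def)

lemma finite_typeII_rels: "finite (typeII_rels m ch)"
proof -
  have "typeII_rels m ch = (\<lambda>(A, B). case_prod typeII (ch A B)) ` (subsets_ge m 2 \<times> subsets_ge m 2)"
    by (auto simp: typeII_rels_def)
  then show ?thesis
    by (metis finite_SigmaI finite_imageI finite_subsets_ge)
qed

text \<open>Since \<open>ch\<close> is symmetric, the two sets may be renamed so that the chosen
  order is the written one.\<close>

lemma typeII_relsE:
  assumes "ordering_choice m ch" "h \<in> typeII_rels m ch"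
  obtains A B where "A \<in> subsets_ge m 2" "B \<in> subsets_ge m 2" "ch A B = (A, B)" "h = typeII A B"
proof -
  obtain A B where "A \<in> subsets_ge m 2" "B \<in> subsets_ge m 2" "h = case_prod typeII (ch A B)"
    using assms(2) by (auto simp: typeII_rels_def)
  moreover from this have "ch A B = (A, B) \<or> ch B A = (B, A)" "ch A B = ch B A"
    using assms(1) by (metis ordering_choice_def)+
  ultimately show ?thesis
    using that[of A B] that[of B A] by auto
qed

lemma rels_subset_kerPi:
  assumes "CHAR('k::comm_ring_1) = 2" "ordering_choice m ch"
  shows "typeI_rels m \<union> typeII_rels m ch \<subseteq> (kerPi m :: (qvar, 'k) mpoly set)"
proof -
  have "typeI_rels m \<subseteq> (kerPi m :: (qvar, 'k) mpoly set)"
    by (auto simp: typeI_rels_def kerPi_def subsets_ge_def piQ_rho[OF assms(1)] finite_subset[of _ "{..<m}"]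
        intro: Qring_rho)
  moreover have "typeII A B \<in> (kerPi m :: (qvar, 'k) mpoly set)"
    if "A \<in> subsets_ge m 2" "B \<in> subsets_ge m 2" for A B
    using card_subsets_ge[OF that(1)] card_subsets_ge[OF that(2)]
    by (simp add: kerPi_def piQ_typeII[OF assms(1)] Qring_typeII)
  ultimately show ?thesis
    by (auto elim!: typeII_relsE[OF assms(2)])
qed

lemma gen_ideal_subset_kerPi:
  assumes "G \<subseteq> kerPi m"
  shows "gen_ideal (Qring m) G \<subseteq> kerPi m"
proof
  fix p assume "p \<in> gen_ideal (Qring m) G"
  then obtain F c where F: "p = (\<Sum>g\<in>F. c g * g)" "F \<subseteq> G" "\<forall>g\<in>F. c g \<in> Qring m"
    by (auto simp: gen_ideal_def)
  have "g \<in> Qring m" "piQ g = 0" if "g \<in> F" for g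
    using that F assms by (auto simp: kerPi_def)
  then show "p \<in> kerPi m"
    unfolding F(1) kerPi_def using F by (auto simp: piQ_sum piQ_mult intro!: Qring_sum Qring_mult)
qed

section \<open>Reduction to normal form\<close>

text \<open>These are the monomials of the ring R in the x and N alone; \<open>base_ring\<close>
  below is R as a subset of Q.\<close>

definition base_monomials :: "nat \<Rightarrow> (qvar \<Rightarrow>\<^sub>0 nat) set" where
  "base_monomials m = {n. keys n \<subseteq> Qx ` {..<m} \<union> QN ` {..<m}}"

definition base_ring :: "nat \<Rightarrow> (qvar, 'k::comm_ring_1) mpoly set" where
  "base_ring m = {p. keys p \<subseteq> base_monomials m}"

text \<open>The type I relation of \<open>insert i B\<close> with \<open>i < Min B\<close> eliminates \<open>x\<^sub>i Tr(B)\<close>,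
  and type II relations eliminate products of traces; these are the monomials that remain.\<close>

definition normal_monomials :: "nat \<Rightarrow> (qvar \<Rightarrow>\<^sub>0 nat) set" where
  "normal_monomials m = base_monomials m \<union>
    {r + single (QT B) 1 | r B. r \<in> base_monomials m \<and> B \<in> subsets_ge m 2 \<and> (\<forall>i<Min B. lookup r (Qx i) = 0)}"

lemma split_monomial:
  fixes n :: "'v \<Rightarrow>\<^sub>0 nat"
  assumes "v \<in> keys n"
  obtains n' where "n = single v 1 + n'" "keys n' \<subseteq> keys n"
proof
  show "n = single v 1 + (n - single v 1)"
    using assms by (intro poly_mapping_eqI) (auto simp: lookup_add lookup_minus lookup_single when_def in_keys_iff)
  show "keys (n - single v 1) \<subseteq> keys n"
    by (auto simp: in_keys_iff lookup_minus)
qed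

lemma base_monomials_add: "a \<in> base_monomials m \<Longrightarrow> b \<in> base_monomials m \<Longrightarrow> a + b \<in> base_monomials m"
  unfolding base_monomials_def using keys_add[of a b] by blast

lemma base_ring_single: "a \<in> base_monomials m \<Longrightarrow> single a c \<in> base_ring m"
  by (simp add: base_ring_def)

lemma base_ring_1 [simp]: "1 \<in> base_ring m"
  by (simp add: base_ring_def base_monomials_def)

lemma base_ring_mult:
  assumes "p \<in> base_ring m" "q \<in> base_ring m"
  shows "p * q \<in> base_ring m"
  using assms unfolding base_ring_def by (auto elim!: in_keys_multE intro!: base_monomials_add)

lemma base_ring_uminus: "p \<in> base_ring m \<Longrightarrow> - p \<in> base_ring m"
  by (auto simp: base_ring_def in_keys_iff subset_iff)

lemma base_ring_prod: "(\<And>i. i \<in> I \<Longrightarrow> f i \<in> base_ring m) \<Longrightarrow> (\<Prod>i\<in>I. f i) \<in> base_ring m"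
  by (induction I rule: infinite_finite_induct) (auto simp: base_ring_mult)

lemma base_ring_Var: "i < m \<Longrightarrow> Var (Qx i) \<in> base_ring m" "i < m \<Longrightarrow> Var (QN i) \<in> base_ring m"
  by (simp_all add: Var_def base_ring_def base_monomials_def)

lemma base_ring_xpow: "A \<subseteq> {..<m} \<Longrightarrow> xpow A \<in> base_ring m"
  unfolding xpow_def by (intro base_ring_prod base_ring_Var) auto

lemma base_ring_Npow: "A \<subseteq> {..<m} \<Longrightarrow> Npow A \<in> base_ring m"
  unfolding Npow_def by (intro base_ring_prod base_ring_Var) auto

lemma base_ring_subset_Qring: "p \<in> base_ring m \<Longrightarrow> p \<in> Qring m"
  by (fastforce simp: base_ring_def base_monomials_def Qring_def qvars_def)

lemma single_normal_cases:
  assumes "a \<in> normal_monomials m"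
  obtains "single a c \<in> base_ring m"
  | B where "B \<in> subsets_ge m 2" "single a c = single (a - single (QT B) 1) c * Tr B"
      "single (a - single (QT B) 1) c \<in> base_ring m"
proof -
  consider "a \<in> base_monomials m" | r B where "a = r + single (QT B) 1" "r \<in> base_monomials m" "B \<in> subsets_ge m 2"
    using assms unfolding normal_monomials_def by blast
  then show ?thesis
  proof cases
    case 1
    then show ?thesis
      using that(1) by (simp add: base_ring_single)
  next
    case 2
    then show ?thesis
      using that(2)[of B] by (simp add: base_ring_single Tr_ge2 card_subsets_ge Var_def mult_single)
  qed
qed

text \<open>Only the existence of a normal remainder is recorded. That the remainder of a kernel
  element is zero comes later from \<open>piQ_inj_normal\<close>.\<close>

definition reducible :: "nat \<Rightarrow> (qvar, 'k::comm_ring_1) mpoly set \<Rightarrow> (qvar, 'k) mpoly \<Rightarrow> bool" where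
  "reducible m G p \<longleftrightarrow> (\<exists>n. keys n \<subseteq> normal_monomials m \<and> p - n \<in> gen_ideal (Qring m) G)"

context
  fixes m :: nat and G :: "(qvar, 'k::comm_ring_1) mpoly set"
  assumes finite_G: "finite G"
    and rho_G: "\<And>A. A \<in> subsets_ge m 3 \<Longrightarrow> rho A \<in> G"
    and typeII_G: "\<And>A B. A \<in> subsets_ge m 2 \<Longrightarrow> B \<in> subsets_ge m 2 \<Longrightarrow> typeII A B \<in> G \<or> typeII B A \<in> G"
begin

lemma reducible_add:
  assumes "reducible m G p" "reducible m G q"
  shows "reducible m G (p + q)"
proof -
  obtain n n' where n: "keys n \<subseteq> normal_monomials m" "p - n \<in> gen_ideal (Qring m) G"
    "keys n' \<subseteq> normal_monomials m" "q - n' \<in> gen_ideal (Qring m) G"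
    using assms by (auto simp: reducible_def)
  have "(p - n) + (q - n') \<in> gen_ideal (Qring m) G"
    using finite_G n by (intro gen_ideal_add)
  moreover have "(p - n) + (q - n') = (p + q) - (n + n')"
    by simp
  moreover have "keys (n + n') \<subseteq> normal_monomials m"
    using keys_add[of n n'] n by blast
  ultimately show ?thesis
    unfolding reducible_def by metis
qed

lemma reducible_ideal: "p \<in> gen_ideal (Qring m) G \<Longrightarrow> reducible m G p"
  unfolding reducible_def by (intro exI[of _ 0]) simp

lemma reducible_ideal_mult: "q \<in> Qring m \<Longrightarrow> p \<in> G \<Longrightarrow> reducible m G (q * p)"
  using finite_G by (intro reducible_ideal gen_ideal_mult gen_ideal_gen)

lemma reducible_normal: "keys p \<subseteq> normal_monomials m \<Longrightarrow> reducible m G p"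
  unfolding reducible_def by (intro exI[of _ p]) (simp add: gen_ideal_0)

lemma reducible_0: "reducible m G 0"
  by (simp add: reducible_normal)

lemma reducible_sum: "(\<And>i. i \<in> I \<Longrightarrow> reducible m G (f i)) \<Longrightarrow> reducible m G (\<Sum>i\<in>I. f i)"
  by (induction I rule: infinite_finite_induct) (auto simp: reducible_add reducible_0)

lemma reducible_base_ring: "p \<in> base_ring m \<Longrightarrow> reducible m G p"
  by (rule reducible_normal) (auto simp: base_ring_def normal_monomials_def)

text \<open>The induction is lexicographic in \<open>card\<close> and \<open>Min\<close>. The
  coefficient is quantified inside it, because rewriting multiplies the new traces by products of x
  that may again violate the support condition.\<close>

lemma reducible_base_ring_mult_Tr:
  assumes "C \<subseteq> {..<m}" "r \<in> base_ring m"
  shows "reducible m G (r * Tr C)"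
proof -
  have "\<forall>r\<in>base_ring m. C \<subseteq> {..<m} \<longrightarrow> reducible m G (r * Tr C)"
  proof (induction C rule: wf_induct_rule[OF wf_measures[of "[card, Min]"]])
    case (1 C)
    have IH: "reducible m G (r * Tr L)"
      if "card L < card C \<or> card L = card C \<and> Min L < Min C" "L \<subseteq> {..<m}" "r \<in> base_ring m" for L r
      using 1[of L] that by (simp add: in_measures)
    have mon: "reducible m G (single a c * Tr C)"
      if C: "C \<in> subsets_ge m 2" and a: "a \<in> base_monomials m" for a c
    proof (cases "\<forall>i<Min C. lookup a (Qx i) = 0")
      case True
      then have "a + single (QT C) 1 \<in> normal_monomials m"
        using a C unfolding normal_monomials_def by blast
      then show ?thesis
        using C by (intro reducible_normal) (simp add: Tr_ge2 card_subsets_ge Var_def mult_single)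
    next
      case False
      then obtain i where i: "i < Min C" "Qx i \<in> keys a"
        by (auto simp: in_keys_iff)
      then obtain a' where a': "a = single (Qx i) 1 + a'" "keys a' \<subseteq> keys a"
        by (metis split_monomial)
      have C': "finite C" "C \<subseteq> {..<m}" "card C \<ge> 2" "C \<noteq> {}"
        using card_subsets_ge[OF C] by auto
      have "i \<notin> C"
        using i C' Min_le[of C i] by auto
      have "i < m"
        using i(1) C' Min_in[of C] by (meson lessThan_iff order_less_trans subsetD)
      define A where "A = insert i C"
      have A: "A \<in> subsets_ge m 3"
        using C' \<open>i \<notin> C\<close> \<open>i < m\<close> by (auto simp: A_def subsets_ge_def)
      have finA: "finite A" "A \<subseteq> {..<m}"
        using card_subsets_ge[OF A] by auto
      let ?s = "single a' c"
      let ?X = "{L. L \<subset> A \<and> L \<noteq> {}} - {C}"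
      have s: "?s \<in> base_ring m"
        using a a' by (auto simp: base_ring_def base_monomials_def)
      have "finite {L. L \<subset> A \<and> L \<noteq> {}}"
        by (rule finite_subset[of _ "Pow A"]) (use finA in auto)
      moreover have "C \<in> {L. L \<subset> A \<and> L \<noteq> {}}"
        using C' \<open>i \<notin> C\<close> by (auto simp: A_def)
      ultimately have "rho A = xpow (A - C) * Tr C + (\<Sum>L\<in>?X. xpow (A - L) * Tr L)"
        unfolding rho_def by (rule sum.remove)
      moreover have "A - C = {i}"
        using \<open>i \<notin> C\<close> by (auto simp: A_def)
      ultimately have rho: "rho A = Var (Qx i) * Tr C + (\<Sum>L\<in>?X. xpow (A - L) * Tr L)"
        by (simp add: xpow_def)
      have "single a c = ?s * Var (Qx i)"
        by (simp add: a' Var_def mult_single add.commute)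
      then have eq: "single a c * Tr C = ?s * rho A + (\<Sum>L\<in>?X. (- ?s * xpow (A - L)) * Tr L)"
        by (simp add: rho distrib_left sum_distrib_left sum_negf mult.assoc)
      have others: "reducible m G ((- ?s * xpow (A - L)) * Tr L)" if L: "L \<in> ?X" for L
      proof (rule IH)
        show "L \<subseteq> {..<m}"
          using L finA by auto
        show "- ?s * xpow (A - L) \<in> base_ring m"
          using s finA by (intro base_ring_mult base_ring_uminus base_ring_xpow) auto
        have "finite L"
          using L finA by (auto intro: finite_subset)
        have "card L < card A"
          using L finA by (intro psubset_card_mono) auto
        then have le: "card L \<le> card C"
          using C' \<open>i \<notin> C\<close> by (simp add: A_def)
        \<comment> \<open>A set \<open>L\<close> containing \<open>i\<close> has minimum at most
          \<open>i\<close>, which is below that of \<open>C\<close>; a set avoiding \<open>i\<close>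
          lies strictly inside \<open>C\<close>.\<close>
        show "card L < card C \<or> card L = card C \<and> Min L < Min C"
        proof (cases "i \<in> L")
          case True
          then have "Min L < Min C"
            using Min_le[OF \<open>finite L\<close> True] i(1) by linarith
          then show ?thesis
            using le by auto
        next
          case False
          then have "L \<subset> C"
            using L by (auto simp: A_def)
          then show ?thesis
            using C' psubset_card_mono by blast
        qed
      qed
      have "reducible m G (?s * rho A)"
        using s A by (intro reducible_ideal_mult rho_G base_ring_subset_Qring)
      then show ?thesis
        unfolding eq by (intro reducible_add reducible_sum others)
    qed
    show ?case
    proof (intro ballI impI)
      fix r :: "(qvar, 'k) mpoly"
      assume r: "r \<in> base_ring m" and "C \<subseteq> {..<m}"
      from this(2) show "reducible m G (r * Tr C)"
      proof (cases rule: Tr_cases)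
        case 1
        then show ?thesis
          by (simp add: reducible_0)
      next
        case (2 s)
        then show ?thesis
          using r by (simp add: reducible_base_ring base_ring_mult base_ring_Var)
      next
        case 3
        have "r * Tr C = (\<Sum>a\<in>keys r. single a (lookup r a) * Tr C)"
          using arg_cong[OF poly_mapping_sum_single[of r], of "\<lambda>p. p * Tr C"] by (simp only: sum_distrib_right)
        then show ?thesis
          using r 3 by (auto simp: base_ring_def intro!: reducible_sum mon)
      qed
    qed
  qed
  then show ?thesis
    using assms by blast
qed

text \<open>Solving a type II relation for its product leaves terms with one trace and coefficients
  in R. The auxiliary claim is proved for arbitrary pairs because \<open>G\<close> need contain only
  one of the two orders, while the product is symmetric.\<close>

lemma reducible_base_ring_mult_Tr_Tr:
  assumes A: "A \<in> subsets_ge m 2" and B: "B \<in> subsets_ge m 2" and r: "r \<in> base_ring m"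
  shows "reducible m G (r * (Tr A * Tr B))"
proof -
  have *: "reducible m G (r * (Tr A * Tr B))"
    if "typeII A B \<in> G" "A \<in> subsets_ge m 2" "B \<in> subsets_ge m 2" for A B
  proof -
    define I J K where "I = A \<inter> B" and "J = A - B" and "K = B - A"
    have sub: "I \<subseteq> {..<m}" "J \<subseteq> {..<m}" "K \<subseteq> {..<m}"
      using card_subsets_ge[OF that(2)] card_subsets_ge[OF that(3)] by (auto simp: I_def J_def K_def)
    have "r * (Tr A * Tr B) = r * typeII A B
      + (\<Sum>L\<in>{L. L \<subset> I}. (- r * (xpow (I - L) * Npow L)) * Tr ((I - L) \<union> J \<union> K))
      + (\<Sum>L\<in>{L. L \<subset> J}. (- r * (Npow I * xpow (J - L))) * Tr (L \<union> K))"
      unfolding typeII_def Let_def I_def[symmetric] J_def[symmetric] K_def[symmetric]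
      by (simp add: distrib_left sum_distrib_left sum_negf mult.assoc)
    also have "reducible m G \<dots>"
      using that r sub
      by (intro reducible_add reducible_sum reducible_ideal_mult reducible_base_ring_mult_Tr base_ring_subset_Qring
            base_ring_mult base_ring_uminus base_ring_xpow base_ring_Npow) auto
    finally show ?thesis .
  qed
  show ?thesis
    using typeII_G[OF A B] *[of A B] *[of B A] A B by (auto simp: mult.commute)
qed

text \<open>A normal term carries at most one trace, so multiplying by a variable never creates more
  than a product of two; the two preceding reductions cover every case.\<close>

lemma reducible_Var_mult:
  assumes p: "reducible m G p" and v: "v \<in> qvars m"
  shows "reducible m G (Var v * p)"
proof -
  obtain n where n: "keys n \<subseteq> normal_monomials m" "p - n \<in> gen_ideal (Qring m) G"
    using p by (auto simp: reducible_def)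
  have mon: "reducible m G (Var v * single a c)" if "a \<in> normal_monomials m" for a c
  proof -
    consider "(Var v :: (qvar, 'k) mpoly) \<in> base_ring m" | A where "A \<in> subsets_ge m 2" "Var v = (Tr A :: (qvar, 'k) mpoly)"
      using v by (auto simp: qvars_def base_ring_Var Tr_ge2 card_subsets_ge)
    then show ?thesis
    proof cases
      case 1
      from that show ?thesis
      proof (cases rule: single_normal_cases[where c = c])
        case 1
        then show ?thesis
          using \<open>Var v \<in> _\<close> by (intro reducible_base_ring base_ring_mult)
      next
        case (2 B)
        then have "reducible m G ((Var v * single (a - single (QT B) 1) c) * Tr B)"
          using 1 by (intro reducible_base_ring_mult_Tr base_ring_mult card_subsets_ge)
        then show ?thesis
          using 2 by (simp add: mult.assoc)
      qed
    next
      case (2 A)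
      from that show ?thesis
      proof (cases rule: single_normal_cases[where c = c])
        case 1
        then have "reducible m G (single a c * Tr A)"
          using 2 by (intro reducible_base_ring_mult_Tr card_subsets_ge)
        then show ?thesis
          using 2 by (simp add: mult.commute)
      next
        case (2 B)
        then have "reducible m G (single (a - single (QT B) 1) c * (Tr A * Tr B))"
          using \<open>A \<in> _\<close> by (intro reducible_base_ring_mult_Tr_Tr)
        then show ?thesis
          using 2 \<open>Var v = _\<close> by (simp add: mult.left_commute)
      qed
    qed
  qed
  have "Var v * p = Var v * (p - n) + Var v * n"
    by (simp add: algebra_simps)
  also have "Var v * n = (\<Sum>a\<in>keys n. Var v * single a (lookup n a))"
    using arg_cong[OF poly_mapping_sum_single[of n], of "\<lambda>p. Var v * p"] by (simp only: sum_distrib_left)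
  also have "reducible m G (Var v * (p - n) + \<dots>)"
    using n v finite_G
    by (intro reducible_add reducible_sum mon reducible_ideal gen_ideal_mult Qring_Var) auto
  finally show ?thesis .
qed

lemma reducible_single: "keys a \<subseteq> qvars m \<Longrightarrow> reducible m G (single a c)"
\<comment> \<open>With all weights equal to 1 the weight is the number of factors.\<close>
proof (induction "weight (\<lambda>_. 1) a" arbitrary: a rule: less_induct)
  case less
  show ?case
  proof (cases "a = 0")
    case True
    then show ?thesis
      by (auto intro!: reducible_base_ring base_ring_single simp: base_monomials_def)
  next
    case False
    then obtain v where v: "v \<in> keys a"
      by (metis all_not_in_conv keys_eq_empty)
    then obtain b where b: "a = single v 1 + b" "keys b \<subseteq> keys a"
      by (rule split_monomial)
    then have "reducible m G (Var v * single b c)"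
      using less v by (intro reducible_Var_mult) auto
    then show ?thesis
      by (simp add: b(1) Var_def mult_single)
  qed
qed

lemma reducible_Qring:
  assumes "p \<in> Qring m"
  shows "reducible m G p"
proof -
  have "reducible m G (\<Sum>a\<in>keys p. single a (lookup p a))"
    using assms by (intro reducible_sum reducible_single) (auto simp: Qring_def)
  then show ?thesis
    by (simp flip: poly_mapping_sum_single)
qed

end

section \<open>Independence of the normal monomials\<close>

text \<open>Replacing \<open>Sy s\<close> by \<open>Sx s\<close> lowers the weight by s + 1: every
  replacement costs something, and the cost grows with the index. On the indices
  \<open>i < m\<close> in use the subtraction is not truncated.\<close>

fun var_weight :: "nat \<Rightarrow> svar \<Rightarrow> nat" where
  "var_weight m (Sx i) = m - i"
| "var_weight m (Sy i) = m + 1"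

fun var_lead :: "qvar \<Rightarrow> (svar \<Rightarrow>\<^sub>0 nat)" where
  "var_lead (Qx i) = single (Sx i) 1"
| "var_lead (QN i) = single (Sy i) 2"
| "var_lead (QT B) = single (Sx (Min B)) 1 + (\<Sum>t\<in>B - {Min B}. single (Sy t) 1)"

lemma lead_trS:
  assumes char2: "CHAR('k::comm_ring_1) = 2" and B: "B \<noteq> {}" "B \<subseteq> {..<m}"
  shows "lead (var_weight m) (trS B :: (svar, 'k) mpoly) (var_lead (QT B))"
proof -
  have fin: "finite B"
    using B finite_subset by blast
  define t :: "nat set \<Rightarrow> svar \<Rightarrow>\<^sub>0 nat"
    where "t C = (\<Sum>s\<in>C. single (Sx s) 1) + (\<Sum>s\<in>B - C. single (Sy s) 1)" for C
  have MinB: "Min B \<in> B"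
    using B fin by simp
  \<comment> \<open>The sum over \<open>C\<close> is the total cost of its replacements, kept on the
    left so that no natural number is subtracted.\<close>
  have tw: "weight (var_weight m) (t C) + (\<Sum>s\<in>C. s + 1) = card B * (m + 1)" if C: "C \<subseteq> B" for C
  proof -
    have "(\<Sum>s\<in>C. m - s) + (\<Sum>s\<in>C. s + 1) = (\<Sum>s\<in>C. m + 1)"
      unfolding sum.distrib[symmetric] using C B(2) by (intro sum.cong) auto
    then have "weight (var_weight m) (t C) + (\<Sum>s\<in>C. s + 1) = card C * (m + 1) + card (B - C) * (m + 1)"
      by (simp add: t_def)
    also have "\<dots> = (card C + card (B - C)) * (m + 1)"
      by (rule distrib_right[symmetric])
    also have "card C + card (B - C) = card B"
      using C fin by (metis card_Diff_subset card_mono finite_subset le_add_diff_inverse)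
    finally show ?thesis .
  qed
  have "(\<Prod>s\<in>B. Var (Sy s) + Var (Sx s)) = (\<Sum>C\<in>Pow B. (\<Prod>s\<in>C. Var (Sx s)) * (\<Prod>s\<in>B - C. Var (Sy s)))"
    unfolding prod_add[OF fin, symmetric] by (simp add: add.commute)
  also have "\<dots> = (\<Sum>C\<in>Pow B. single (t C) (1::'k))"
    using fin by (intro sum.cong) (auto simp: Var_def single_prod mult_single t_def finite_subset)
  also have "\<dots> = single (t {}) 1 + (\<Sum>C\<in>Pow B - {{}}. single (t C) 1)"
    using fin by (intro sum.remove) auto
  also have "(\<Sum>C\<in>Pow B - {{}}. single (t C) (1::'k))
      = single (t {Min B}) 1 + (\<Sum>C\<in>Pow B - {{}} - {{Min B}}. single (t C) 1)"
    using fin MinB by (intro sum.remove) auto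
  \<comment> \<open>The term at \<open>C = {}\<close> is the y-product over \<open>B\<close>; with
    the first half of the trace it appears twice.\<close>
  finally have "trS B = (single (t {}) 1 + single (t {}) 1)
      + (single (t {Min B}) 1 + (\<Sum>C\<in>Pow B - {{}} - {{Min B}}. single (t C) (1::'k)))"
    using fin by (simp add: trS_def Var_def single_prod t_def add.assoc)
  then have eq: "trS B - single (t {Min B}) 1 = (\<Sum>C\<in>Pow B - {{}} - {{Min B}}. single (t C) (1::'k))"
    by (simp only: mpoly_add_self[OF char2]) simp
  have "weight (var_weight m) u < weight (var_weight m) (t {Min B})"
    if u: "u \<in> keys (trS B - single (t {Min B}) (1::'k))" for u
  proof -
    obtain C where C: "C \<subseteq> B" "C \<noteq> {}" "C \<noteq> {Min B}" "u = t C"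
      using u keys_sum[of "\<lambda>C. single (t C) (1::'k)" "Pow B - {{}} - {{Min B}}"] unfolding eq by auto
    \<comment> \<open>A single replacement away from the minimum already costs more than the one at
      \<open>Min B\<close>.\<close>
    then obtain s where s: "s \<in> C" "s \<noteq> Min B"
      by blast
    have "Min B \<le> s"
      using s C fin by (intro Min_le) auto
    then have "Min B + 1 < s + 1"
      using s by simp
    also have "s + 1 \<le> (\<Sum>s\<in>C. s + 1)"
      using s C fin by (intro member_le_sum) (auto intro: finite_subset)
    finally show ?thesis
      using tw[of C] tw[of "{Min B}"] C MinB by simp
  qed
  then show ?thesis
    by (simp add: lead_def t_def)
qed

lemma lead_pi_img:
  assumes "CHAR('k::comm_ring_1) = 2" "v \<in> qvars m"
  shows "lead (var_weight m) (pi_img v :: (svar, 'k) mpoly) (var_lead v)"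
proof (cases v)
  case (Qx i)
  then show ?thesis
    by (simp add: lead_def pi_img_def Var_def)
next
  case (QN i)
  have "pi_img v - single (var_lead v) 1 = single (single (Sx i) 1 + single (Sy i) 1) (1::'k)"
    by (simp add: QN pi_img_def Var_def mult_single power2_eq_square numeral_2_eq_2 flip: single_add)
  then show ?thesis
    by (simp add: lead_def QN)
next
  case (QT B)
  then have "B \<subseteq> {..<m}" "B \<noteq> {}"
    using assms(2) by (auto simp: qvars_def subsets_ge_def)
  then show ?thesis
    using lead_trS[OF assms(1)] by (simp add: QT pi_img_def)
qed

lemma lead_mon_base:
  assumes "r \<in> base_monomials m"
  shows "lookup (lead_mon var_lead r) (Sx i) = lookup r (Qx i)"
    and "lookup (lead_mon var_lead r) (Sy i) = 2 * lookup r (QN i)"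
proof -
  have *: "lookup r v * lookup (var_lead v) (Sx i) = (if v = Qx i then lookup r v else 0)"
    "lookup r v * lookup (var_lead v) (Sy i) = (if v = QN i then 2 * lookup r v else 0)"
    if "v \<in> keys r" for v
  proof -
    have "v \<in> Qx ` {..<m} \<union> QN ` {..<m}"
      using that assms unfolding base_monomials_def by blast
    then consider j where "v = Qx j" | j where "v = QN j"
      by auto
    then show "lookup r v * lookup (var_lead v) (Sx i) = (if v = Qx i then lookup r v else 0)"
      "lookup r v * lookup (var_lead v) (Sy i) = (if v = QN i then 2 * lookup r v else 0)"
      by (cases; simp add: lookup_single when_def)+
  qed
  have "lookup (lead_mon var_lead r) (Sx i) = (\<Sum>v\<in>keys r. if v = Qx i then lookup r v else 0)"
    unfolding lookup_lead_mon weight_def by (intro sum.cong refl *)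
  then show "lookup (lead_mon var_lead r) (Sx i) = lookup r (Qx i)"
    by (simp add: in_keys_iff)
  have "lookup (lead_mon var_lead r) (Sy i) = (\<Sum>v\<in>keys r. if v = QN i then 2 * lookup r v else 0)"
    unfolding lookup_lead_mon weight_def by (intro sum.cong refl *)
  then show "lookup (lead_mon var_lead r) (Sy i) = 2 * lookup r (QN i)"
    by (simp add: in_keys_iff)
qed

lemma lead_mon_0 [simp]: "lead_mon l 0 = 0"
  by (simp add: lead_mon_def)

lemma lead_mon_add: "lookup (lead_mon l (a + b)) u = lookup (lead_mon l a) u + lookup (lead_mon l b) u"
  by (simp add: lookup_lead_mon)

lemma lead_mon_QT:
  assumes "finite B"
  shows "lookup (lead_mon var_lead (single (QT B) 1)) (Sx i) = of_bool (i = Min B)"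
    and "lookup (lead_mon var_lead (single (QT B) 1)) (Sy i) = of_bool (i \<in> B - {Min B})"
  using assms by (simp_all add: lookup_lead_mon lookup_add lookup_sum lookup_single when_def)

text \<open>Coding the absence of a trace by \<open>B = {}\<close> lets both kinds of normal
  monomials be compared by one formula. The condition \<open>card B \<noteq> 1\<close> keeps the
  code unambiguous: \<open>B\<close> is empty as soon as \<open>B - {Min B}\<close> is.\<close>

lemma normal_monomialsE:
  assumes "n \<in> normal_monomials m"
  obtains r B where "r \<in> base_monomials m" "n = r + (if B = {} then 0 else single (QT B) 1)"
    "finite B" "card B \<noteq> 1" "B \<noteq> {} \<longrightarrow> (\<forall>i<Min B. lookup r (Qx i) = 0)"
proof -
  consider "n \<in> base_monomials m" | r B where "n = r + single (QT B) 1" "r \<in> base_monomials m"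
      "B \<in> subsets_ge m 2" "\<forall>i<Min B. lookup r (Qx i) = 0"
    using assms unfolding normal_monomials_def by blast
  then show ?thesis
  proof cases
    case 1
    then show ?thesis
      using that[of n "{}"] by simp
  next
    case (2 r B)
    then have "finite B" "card B \<noteq> 1" "B \<noteq> {}"
      using card_subsets_ge[of B m 2] by auto
    then show ?thesis
      using that[of r B] 2 by simp
  qed
qed

text \<open>Norms contribute even y-exponents, so parity recovers \<open>B - {Min B}\<close>. If the
  minima differed, then at the smaller one the monomial owning it would have a positive x-exponent,
  while the support condition makes the exponent of the other zero.\<close>

lemma inj_on_lead_mon: "inj_on (lead_mon var_lead) (normal_monomials m)"
proof (rule inj_onI)
  fix n n' assume n: "n \<in> normal_monomials m" and n': "n' \<in> normal_monomials m"
    and eq: "lead_mon var_lead n = lead_mon var_lead n'"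
  obtain r B where r: "r \<in> base_monomials m" "n = r + (if B = {} then 0 else single (QT B) 1)"
    "finite B" "card B \<noteq> 1" "B \<noteq> {} \<longrightarrow> (\<forall>i<Min B. lookup r (Qx i) = 0)"
    using n by (rule normal_monomialsE)
  obtain r' B' where r': "r' \<in> base_monomials m" "n' = r' + (if B' = {} then 0 else single (QT B') 1)"
    "finite B'" "card B' \<noteq> 1" "B' \<noteq> {} \<longrightarrow> (\<forall>i<Min B'. lookup r' (Qx i) = 0)"
    using n' by (rule normal_monomialsE)
  have x: "lookup (lead_mon var_lead (r + (if B = {} then 0 else single (QT B) 1))) (Sx i)
      = lookup r (Qx i) + of_bool (B \<noteq> {} \<and> i = Min B)"
    and y: "lookup (lead_mon var_lead (r + (if B = {} then 0 else single (QT B) 1))) (Sy i)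
      = 2 * lookup r (QN i) + of_bool (i \<in> B - {Min B})"
    if "r \<in> base_monomials m" "finite B" for r B i
    using that lead_mon_QT[of B i] by (auto simp: lead_mon_add lead_mon_base)
  have eqx: "lookup r (Qx i) + of_bool (B \<noteq> {} \<and> i = Min B) = lookup r' (Qx i) + of_bool (B' \<noteq> {} \<and> i = Min B')"
    and eqy: "2 * lookup r (QN i) + of_bool (i \<in> B - {Min B}) = 2 * lookup r' (QN i) + of_bool (i \<in> B' - {Min B'})" for i
    using x[OF r(1,3), of i] x[OF r'(1,3), of i] y[OF r(1,3), of i] y[OF r'(1,3), of i] eq r(2) r'(2) by simp_all
  have rest: "B - {Min B} = B' - {Min B'}"
  proof (rule set_eqI)
    fix i
    have "odd (2 * lookup r (QN i) + of_bool (i \<in> B - {Min B}))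
       = odd (2 * lookup r' (QN i) + of_bool (i \<in> B' - {Min B'}))"
      by (simp only: eqy)
    then show "i \<in> B - {Min B} \<longleftrightarrow> i \<in> B' - {Min B'}"
      by (auto split: if_splits)
  qed
  have ne: "C = {}" if "card C \<noteq> 1" "C - {Min C} = {}" for C :: "nat set"
  proof -
    have "C = {} \<or> C = {Min C}"
      using that(2) by blast
    then show ?thesis
      using that(1) card_1_singleton_iff[of C] by auto
  qed
  have empty: "B = {} \<longleftrightarrow> B' = {}"
    using ne[OF r(4)] ne[OF r'(4)] rest by auto
  have Min: "Min B = Min B'"
  proof (cases "B = {}")
    case False
    then show ?thesis
      using empty eqx[of "Min B"] eqx[of "Min B'"] r(5) r'(5)
      by (cases "Min B" "Min B'" rule: linorder_cases) auto
  qed (use empty in simp)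
  have "B = B'"
  proof (cases "B = {}")
    case False
    then have "Min B \<in> B" "Min B' \<in> B'"
      using empty r r' by auto
    then show ?thesis
      using rest Min insert_Diff[of "Min B" B] insert_Diff[of "Min B'" B'] by simp
  qed (use empty in simp)
  moreover have "lookup r v = lookup r' v" for v
  proof (cases v)
    case (Qx i)
    then show ?thesis
      using eqx[of i] \<open>B = B'\<close> by simp
  next
    case (QN i)
    then show ?thesis
      using eqy[of i] \<open>B = B'\<close> by simp
  next
    case (QT A)
    then have "v \<notin> keys r" "v \<notin> keys r'"
      using r(1) r'(1) by (auto simp: base_monomials_def)
    then show ?thesis
      by (simp add: in_keys_iff)
  qed
  then have "r = r'"
    by (rule poly_mapping_eqI)
  ultimately show "n = n'"
    using r(2) r'(2) by simp
qed

lemma normal_monomials_qvars: "n \<in> normal_monomials m \<Longrightarrow> keys n \<subseteq> qvars m"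
  unfolding normal_monomials_def base_monomials_def qvars_def
  using keys_add[of _ "single (QT _) (1::nat)"] by (auto split: if_splits dest!: subsetD)

lemma piQ_inj_normal:
  assumes "CHAR('k::comm_ring_1) = 2" "keys p \<subseteq> normal_monomials m" "piQ p = (0 :: (svar, 'k) mpoly)"
  shows "p = 0"
proof (rule eq_0_if_leads_distinct)
  show "lead (var_weight m) (meval pi_img n :: (svar, 'k) mpoly) (lead_mon var_lead n)" if "n \<in> keys p" for n
    using that assms(2) normal_monomials_qvars by (intro lead_meval lead_pi_img[OF assms(1)]) blast
  show "inj_on (lead_mon var_lead) (keys p)"
    using inj_on_lead_mon assms(2) by (rule inj_on_subset)
  show "peval pi_img Const p = 0"
    using assms(3) by (simp add: piQ_def)
qed

text \<open>Subtracting an ideal element does not change the image, so the normal remainder of a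
  kernel element has image 0 and must vanish.\<close>

lemma gen_ideal_eq_kerPi:
  assumes char2: "CHAR('k::comm_ring_1) = 2" and ch: "ordering_choice m ch"
  shows "gen_ideal (Qring m) (typeI_rels m \<union> typeII_rels m ch) = (kerPi m :: (qvar, 'k) mpoly set)"
proof
  let ?G = "typeI_rels m \<union> typeII_rels m ch :: (qvar, 'k) mpoly set"
  show sub: "gen_ideal (Qring m) ?G \<subseteq> kerPi m"
    by (intro gen_ideal_subset_kerPi rels_subset_kerPi char2 ch)
  show "kerPi m \<subseteq> gen_ideal (Qring m) ?G"
  proof
    fix p :: "(qvar, 'k) mpoly"
    assume p: "p \<in> kerPi m"
    have "reducible m ?G p"
    proof (rule reducible_Qring)
      show "typeII A B \<in> ?G \<or> typeII B A \<in> ?G" if "A \<in> subsets_ge m 2" "B \<in> subsets_ge m 2" for A B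
      proof -
        have "case_prod typeII (ch A B) \<in> ?G"
          using that by (auto simp: typeII_rels_def)
        moreover have "ch A B = (A, B) \<or> ch A B = (B, A)"
          using ch that by (auto simp: ordering_choice_def)
        ultimately show ?thesis
          by auto
      qed
    qed (use p in \<open>auto simp: finite_typeI_rels finite_typeII_rels typeI_rels_def kerPi_def\<close>)
    then obtain n where n: "keys n \<subseteq> normal_monomials m" "p - n \<in> gen_ideal (Qring m) ?G"
      by (auto simp: reducible_def)
    have "piQ n = piQ p"
      using n(2) sub piQ_add[of "p - n" n] by (auto simp: kerPi_def)
    then have "n = 0"
      using p n by (intro piQ_inj_normal[OF char2]) (auto simp: kerPi_def)
    then show "p \<in> gen_ideal (Qring m) ?G"
      using n by simp
  qed
qed

section \<open>Minimality\<close>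

text \<open>Every relation is a combination of monomials with at least two factors. The coefficients at
  monomials with exactly two factors are not affected by multiples with non-constant coefficients,
  and they already separate the relations: \<open>Tr(A) Tr(B)\<close> occurs only in the type II relation of
  \<open>{A, B}\<close>, and among the type I relations \<open>x\<^sub>s Tr(A - {s})\<close> occurs only in \<open>rho A\<close>.\<close>

fun is_Qx :: "qvar \<Rightarrow> nat" where
  "is_Qx (Qx i) = 1"
| "is_Qx _ = 0"

text \<open>Every trace counts as a single factor here, unlike in the grading of Q. Requiring a
  factor x excludes all products of two traces; the set is closed under addition and under arbitrary
  multiples.\<close>

definition tail_polys :: "(qvar, 'k::comm_ring_1) mpoly set" where
  "tail_polys = {p. \<forall>u\<in>keys p. weight is_Qx u \<ge> 1 \<and> weight (\<lambda>_. 1) u \<ge> 2}"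

lemma tail_polys_mult: "p \<in> tail_polys \<Longrightarrow> q * p \<in> tail_polys"
  unfolding tail_polys_def by (fastforce elim!: in_keys_multE)

lemma tail_polys_add: "p \<in> tail_polys \<Longrightarrow> q \<in> tail_polys \<Longrightarrow> p + q \<in> tail_polys"
  unfolding tail_polys_def using keys_add[of p q] by blast

lemma tail_polys_0: "0 \<in> tail_polys"
  by (simp add: tail_polys_def)

lemma tail_polys_sum: "(\<And>i. i \<in> I \<Longrightarrow> f i \<in> tail_polys) \<Longrightarrow> (\<Sum>i\<in>I. f i) \<in> tail_polys"
  by (induction I rule: infinite_finite_induct) (simp_all add: tail_polys_add tail_polys_0)

lemma tail_polys_xpow_Tr:
  assumes "C \<noteq> {}" "finite C"
  shows "xpow C * Tr L \<in> (tail_polys :: (qvar, 'k::comm_ring_1) mpoly set)"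
proof -
  obtain i where "i \<in> C"
    using assms by blast
  then have xpow: "xpow C = Var (Qx i) * (xpow (C - {i}) :: (qvar, 'k) mpoly)"
    unfolding xpow_def using assms by (intro prod.remove)
  have "Var (Qx i) * (Tr L :: (qvar, 'k) mpoly) \<in> tail_polys"
    by (simp add: Tr_def Var_def mult_single tail_polys_def)
  then have "xpow (C - {i}) * (Var (Qx i) * (Tr L :: (qvar, 'k) mpoly)) \<in> tail_polys"
    by (rule tail_polys_mult)
  then show ?thesis
    by (simp add: xpow mult_ac)
qed

lemma rho_tail_polys:
  assumes "finite A"
  shows "rho A \<in> tail_polys"
  unfolding rho_def using assms by (intro tail_polys_sum tail_polys_xpow_Tr) auto

definition Tr_Tr_mon :: "nat set \<Rightarrow> nat set \<Rightarrow> (qvar \<Rightarrow>\<^sub>0 nat)" where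
  "Tr_Tr_mon A B = single (QT A) 1 + single (QT B) 1"

definition x_Tr_mon :: "nat \<Rightarrow> nat set \<Rightarrow> (qvar \<Rightarrow>\<^sub>0 nat)" where
  "x_Tr_mon s B = single (Qx s) 1 + single (QT B) 1"

text \<open>Both sums run over proper subsets, so each of their terms has a nonempty product of x
  beside its trace.\<close>

lemma typeII_tail:
  assumes "A \<in> subsets_ge m 2" "B \<in> subsets_ge m 2"
  obtains p where "p \<in> tail_polys" "typeII A B = single (Tr_Tr_mon A B) 1 + p"
proof
  define I J K where "I = A \<inter> B" and "J = A - B" and "K = B - A"
  have fin: "finite I" "finite J"
    using card_subsets_ge[OF assms(1)] by (auto simp: I_def J_def)
  let ?p = "(\<Sum>L\<in>{L. L \<subset> I}. Npow L * (xpow (I - L) * Tr ((I - L) \<union> J \<union> K)))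
     + Npow I * (\<Sum>L\<in>{L. L \<subset> J}. xpow (J - L) * Tr (L \<union> K))"
  show "?p \<in> tail_polys"
    using fin by (intro tail_polys_add tail_polys_sum tail_polys_mult tail_polys_xpow_Tr) auto
  have "Tr A * Tr B = single (Tr_Tr_mon A B) 1"
    using assms by (simp add: Tr_ge2 card_subsets_ge Var_def mult_single Tr_Tr_mon_def)
  then show "typeII A B = single (Tr_Tr_mon A B) 1 + ?p"
    by (simp add: typeII_def Let_def mult_ac flip: I_def J_def K_def)
qed

lemma tail_polys_lookup: "p \<in> tail_polys \<Longrightarrow> lookup p (Tr_Tr_mon A B) = 0"
  by (force simp: tail_polys_def Tr_Tr_mon_def in_keys_iff)

lemma lookup_rho_Tr_Tr: "A' \<in> subsets_ge m k \<Longrightarrow> lookup (rho A') (Tr_Tr_mon A B) = 0"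
  by (intro tail_polys_lookup rho_tail_polys card_subsets_ge)

lemma lookup_typeII_Tr_Tr:
  assumes "A' \<in> subsets_ge m 2" "B' \<in> subsets_ge m 2"
  shows "lookup (typeII A' B' :: (qvar, 'k::comm_ring_1) mpoly) (Tr_Tr_mon A B) = of_bool (Tr_Tr_mon A' B' = Tr_Tr_mon A B)"
proof -
  obtain p :: "(qvar, 'k) mpoly" where "p \<in> tail_polys" "typeII A' B' = single (Tr_Tr_mon A' B') 1 + p"
    using assms by (rule typeII_tail)
  then show ?thesis
    by (simp add: lookup_add tail_polys_lookup lookup_single)
qed

lemma Tr_Tr_mon_eqD:
  assumes "Tr_Tr_mon A B = Tr_Tr_mon A' B'"
  shows "{A, B} = {A', B'}"
proof -
  have "keys (Tr_Tr_mon A B) = {QT A, QT B}" for A B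
    by (auto simp: Tr_Tr_mon_def in_keys_iff lookup_add lookup_single when_def split: if_splits)
  then have "{QT A, QT B} = {QT A', QT B'}"
    using assms by metis
  then show ?thesis
    by (auto simp: doubleton_eq_iff)
qed

lemma rel_weight:
  assumes "ordering_choice m ch" "h \<in> typeI_rels m \<union> typeII_rels m ch" "u \<in> keys h"
  shows "weight (\<lambda>_. 1) u \<ge> 2"
proof (cases "h \<in> typeI_rels m")
  case True
  then have "h \<in> tail_polys"
    by (auto simp: typeI_rels_def card_subsets_ge intro!: rho_tail_polys)
  then show ?thesis
    using assms(3) by (simp add: tail_polys_def)
next
  case False
  then obtain A B where AB: "A \<in> subsets_ge m 2" "B \<in> subsets_ge m 2" "h = typeII A B"
    using assms by (auto elim: typeII_relsE)
  then obtain p where p: "p \<in> tail_polys" "h = single (Tr_Tr_mon A B) 1 + p"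
    by (metis typeII_tail)
  then have "u = Tr_Tr_mon A B \<or> u \<in> keys p"
    using assms(3) keys_add[of "single (Tr_Tr_mon A B) 1" p] by auto
  then show ?thesis
    using p by (auto simp: tail_polys_def Tr_Tr_mon_def)
qed

text \<open>Because \<open>A\<close> has at least three elements, \<open>Tr (A - {s})\<close> is a
  variable of its own and not some x. The monomial then reveals both \<open>L\<close> and
  \<open>A' - L\<close>, and hence \<open>A'\<close>.\<close>

lemma lookup_rho_x_Tr:
  assumes A: "A \<in> subsets_ge m 3" and s: "s \<in> A" and A': "A' \<in> subsets_ge m 3"
  shows "lookup (rho A' :: (qvar, 'k::comm_ring_1) mpoly) (x_Tr_mon s (A - {s})) = of_bool (A' = A)"
proof -
  let ?X = "{L. L \<subset> A' \<and> L \<noteq> {}}"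
  have cardA: "card (A - {s}) \<ge> 2"
    using card_subsets_ge[OF A] s by (simp add: card_Diff_singleton)
  have finA': "finite A'"
    using card_subsets_ge[OF A'] by blast
  then have finX: "finite ?X"
    by (intro finite_subset[of ?X "Pow A'"]) auto
  have coeff: "lookup (xpow (A' - L) * Tr L :: (qvar, 'k) mpoly) (x_Tr_mon s (A - {s})) = of_bool (A' = A \<and> L = A - {s})"
    if L: "L \<in> ?X" for L
  proof -
    define e where "e = (\<Sum>i\<in>A' - L. single (Qx i) (1::nat))"
    have e: "lookup e (Qx i) = of_bool (i \<in> A' - L)" "lookup e (QT B) = 0" for i B
      using finA' by (auto simp: e_def lookup_sum lookup_single when_def sum.delta)
    have xpow: "xpow (A' - L) = (single e 1 :: (qvar, 'k) mpoly)"
      using finA' by (simp add: xpow_def Var_def single_prod e_def)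
    have "finite L"
      using L finA' by (auto intro: finite_subset)
    then have "card L \<noteq> 0"
      using L by simp
    then have "card L = 1 \<or> card L \<ge> 2"
      by linarith
    then consider i where "L = {i}" | "card L \<ge> 2"
      by (elim disjE card_1_singletonE)
    then show ?thesis
    proof cases
      case (1 i)
      have "e + single (Qx i) 1 \<noteq> x_Tr_mon s (A - {s})"
      proof
        assume eq: "e + single (Qx i) 1 = x_Tr_mon s (A - {s})"
        have "lookup (e + single (Qx i) 1) (QT (A - {s})) = 1"
          unfolding eq by (simp add: x_Tr_mon_def lookup_add lookup_single)
        then show False
          by (simp add: e lookup_add lookup_single)
      qed
      moreover have "{i} \<noteq> A - {s}"
      proof
        assume "{i} = A - {s}"
        then show False
          using cardA by (simp flip: \<open>{i} = A - {s}\<close>)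
      qed
      moreover have "Tr L = (single (single (Qx i) 1) 1 :: (qvar, 'k) mpoly)"
        by (simp add: \<open>L = {i}\<close> Var_def)
      ultimately show ?thesis
        unfolding xpow by (simp add: \<open>L = {i}\<close> mult_single lookup_single)
    next
      case 2
      have "e + single (QT L) 1 = x_Tr_mon s (A - {s}) \<longleftrightarrow> A' = A \<and> L = A - {s}"
      proof
        assume eq: "e + single (QT L) 1 = x_Tr_mon s (A - {s})"
        have "lookup (e + single (QT L) 1) (QT (A - {s})) = 1"
          unfolding eq by (simp add: x_Tr_mon_def lookup_add lookup_single)
        then have "L = A - {s}"
          by (auto simp: e lookup_add lookup_single when_def split: if_splits)
        moreover have "i \<in> A' - L \<longleftrightarrow> i = s" for i
        proof -
          have "lookup (e + single (QT L) 1) (Qx i) = of_bool (i = s)"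
            unfolding eq by (simp add: x_Tr_mon_def lookup_add lookup_single)
          then show ?thesis
            by (auto simp: e lookup_add lookup_single of_bool_def split: if_splits)
        qed
        then have "A' = insert s L"
          using L by blast
        ultimately show "A' = A \<and> L = A - {s}"
          using s by blast
      next
        assume "A' = A \<and> L = A - {s}"
        moreover from this have "A' - L = {s}"
          using s by auto
        ultimately show "e + single (QT L) 1 = x_Tr_mon s (A - {s})"
          by (simp add: e_def x_Tr_mon_def)
      qed
      then show ?thesis
        using 2 by (simp add: xpow Tr_ge2 Var_def mult_single lookup_single)
    qed
  qed
  have "A - {s} \<noteq> {}"
  proof
    assume "A - {s} = {}"
    then show False
      using cardA by (simp only: card.empty)
  qed
  then have "A - {s} \<in> {L. L \<subset> A \<and> L \<noteq> {}}"
    using s by blast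
  then have "(\<Sum>L\<in>?X. of_bool (A' = A \<and> L = A - {s})) = (of_bool (A' = A) :: 'k)"
    using finX by (cases "A' = A") (auto simp: of_bool_def sum.delta)
  then show ?thesis
    by (simp add: rho_def lookup_sum coeff)
qed

lemma typeII_pair_unique:
  assumes "ordering_choice m ch" "A \<in> subsets_ge m 2" "B \<in> subsets_ge m 2"
    and "ch A B = (A, B)" "ch A' B' = (A', B')" "{A, B} = {A', B'}"
  shows "A = A'" "B = B'"
proof -
  have "ch A B = ch B A"
    using assms(1-3) unfolding ordering_choice_def by blast
  moreover have "A = A' \<and> B = B' \<or> A' = B \<and> B' = A"
    using assms(6) unfolding doubleton_eq_iff by blast
  ultimately have "A = A' \<and> B = B'"
  proof (elim disjE)
    assume "A' = B \<and> B' = A"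
    then have "(A, B) = (B, A)"
      using \<open>ch A B = ch B A\<close> assms(4,5) by metis
    then show "A = A' \<and> B = B'"
      using \<open>A' = B \<and> B' = A\<close> by blast
  qed
  then show "A = A'" "B = B'"
    by blast+
qed

lemma lookup_rel_Tr_Tr:
  fixes h :: "(qvar, 'k::comm_ring_1) mpoly"
  assumes ch: "ordering_choice m ch" and h: "h \<in> typeI_rels m \<union> typeII_rels m ch"
    and AB: "A \<in> subsets_ge m 2" "B \<in> subsets_ge m 2" "ch A B = (A, B)"
  shows "lookup h (Tr_Tr_mon A B) = of_bool (h = typeII A B)"
proof (cases "h \<in> typeI_rels m")
  case True
  then have "lookup h (Tr_Tr_mon A B) = 0"
    by (auto simp: typeI_rels_def lookup_rho_Tr_Tr)
  moreover from this have "h \<noteq> typeII A B"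
    using AB by (auto simp: lookup_typeII_Tr_Tr)
  ultimately show ?thesis
    by simp
next
  case False
  then obtain A' B' where A'B': "A' \<in> subsets_ge m 2" "B' \<in> subsets_ge m 2" "ch A' B' = (A', B')" "h = typeII A' B'"
    using h ch by (auto elim: typeII_relsE)
  have "A = A' \<and> B = B'" if "Tr_Tr_mon A' B' = Tr_Tr_mon A B"
    using typeII_pair_unique[OF ch AB A'B'(3)] Tr_Tr_mon_eqD[OF that] by simp
  then have "h = typeII A B" if "Tr_Tr_mon A' B' = Tr_Tr_mon A B"
    using that A'B' by simp
  moreover have "Tr_Tr_mon A' B' = Tr_Tr_mon A B" if "h = typeII A B"
    using lookup_typeII_Tr_Tr[OF A'B'(1,2), of A B, where 'k = 'k] lookup_typeII_Tr_Tr[OF AB(1,2), of A B, where 'k = 'k]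
      that A'B' by (auto split: if_splits)
  ultimately show ?thesis
    using A'B' by (auto simp: lookup_typeII_Tr_Tr)
qed

lemma typeI_typeII_disjoint:
  assumes "ordering_choice m ch"
  shows "typeI_rels m \<inter> typeII_rels m ch = ({} :: (qvar, 'k::comm_ring_1) mpoly set)"
proof (rule equals0I)
  fix h :: "(qvar, 'k) mpoly"
  assume h: "h \<in> typeI_rels m \<inter> typeII_rels m ch"
  then obtain A B where "A \<in> subsets_ge m 2" "B \<in> subsets_ge m 2" "h = typeII A B"
    using assms by (auto elim: typeII_relsE)
  moreover obtain A' where "A' \<in> subsets_ge m 3" "h = rho A'"
    using h by (auto simp: typeI_rels_def)
  ultimately show False
    using lookup_typeII_Tr_Tr[of A m B A B, where 'k = 'k] lookup_rho_Tr_Tr[of A' m 3 A B, where 'a = 'k] by simp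
qed

text \<open>Comparing coefficients at products of two traces settles the case of a type II relation.
  For \<open>g = rho A\<close> this is not enough: if \<open>A\<close> is the disjoint union of
  \<open>A'\<close> and \<open>B'\<close> with \<open>s\<close> in \<open>A'\<close>, then
  \<open>typeII A' B'\<close> contains the test monomial of \<open>rho A\<close>. But
  \<open>g\<close> has no product of two traces, so the coefficient of each type II relation has
  constant term 0, and only type I relations remain to be compared.\<close>

lemma rel_notin_gen_ideal:
  assumes ch: "ordering_choice m ch" and g: "g \<in> typeI_rels m \<union> typeII_rels m ch"
    and G': "G' \<subseteq> typeI_rels m \<union> typeII_rels m ch - {g}"
  shows "g \<notin> gen_ideal (Qring m) G'"
proof
  assume "g \<in> gen_ideal (Qring m) G'"
  then obtain F c where F: "g = (\<Sum>h\<in>F. c h * h)" "finite F" "F \<subseteq> G'"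
    by (auto simp: gen_ideal_def)
  have rel: "h \<in> typeI_rels m \<union> typeII_rels m ch" "h \<noteq> g" if "h \<in> F" for h
    using that F G' by auto
  have coeff: "lookup g n = (\<Sum>h\<in>F. lookup (c h) 0 * lookup h n)" if "weight (\<lambda>_. 1) n = 2" for n
  proof -
    have "lookup (c h * h) n = lookup (c h) 0 * lookup h n" if "h \<in> F" for h
      using rel_weight[OF ch rel(1)[OF that]] \<open>weight _ n = 2\<close>
      by (intro lookup_mult_lowest_weight[of "\<lambda>_. 1"]) auto
    then show ?thesis
      by (simp add: F(1) lookup_sum)
  qed
  have typeII_coeff: "of_bool (g = typeII A B) = (if typeII A B \<in> F then lookup (c (typeII A B)) 0 else 0)"
    if AB: "A \<in> subsets_ge m 2" "B \<in> subsets_ge m 2" "ch A B = (A, B)" for A B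
  proof -
    have "of_bool (g = typeII A B) = lookup g (Tr_Tr_mon A B)"
      by (simp only: lookup_rel_Tr_Tr[OF ch g AB])
    also have "\<dots> = (\<Sum>h\<in>F. lookup (c h) 0 * lookup h (Tr_Tr_mon A B))"
      by (rule coeff) (simp add: Tr_Tr_mon_def)
    also have "\<dots> = (\<Sum>h\<in>F. if h = typeII A B then lookup (c h) 0 else 0)"
      by (intro sum.cong refl) (simp add: lookup_rel_Tr_Tr[OF ch rel(1) AB])
    also have "\<dots> = (if typeII A B \<in> F then lookup (c (typeII A B)) 0 else 0)"
      using F by (simp add: sum.delta)
    finally show ?thesis .
  qed
  show False
  proof (cases "g \<in> typeI_rels m")
    case False
    then obtain A B where "A \<in> subsets_ge m 2" "B \<in> subsets_ge m 2" "ch A B = (A, B)" "g = typeII A B"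
      using g ch by (auto elim: typeII_relsE)
    then show False
      using typeII_coeff[of A B] rel by (auto split: if_splits)
  next
    case True
    then obtain A where A: "A \<in> subsets_ge m 3" "g = rho A"
      by (auto simp: typeI_rels_def)
    then obtain s where s: "s \<in> A"
      using card_subsets_ge(3)[OF A(1)] by fastforce
    let ?n = "x_Tr_mon s (A - {s})"
    have "lookup (c h) 0 * lookup h ?n = 0" if h: "h \<in> F" for h
    proof (cases "h \<in> typeI_rels m")
      case True
      then obtain A' where "A' \<in> subsets_ge m 3" "h = rho A'"
        by (auto simp: typeI_rels_def)
      then show ?thesis
        using rel[OF h] A s by (auto simp: lookup_rho_x_Tr)
    next
      case False
      then obtain A' B' where "A' \<in> subsets_ge m 2" "B' \<in> subsets_ge m 2" "ch A' B' = (A', B')" "h = typeII A' B'"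
        using rel[OF h] ch by (auto elim: typeII_relsE)
      then show ?thesis
        using typeII_coeff[of A' B'] rel[OF h] h by auto
    qed
    then have "lookup g ?n = 0"
      using coeff[of ?n] by (simp add: x_Tr_mon_def)
    then show False
      using A s by (simp add: lookup_rho_x_Tr)
  qed
qed

text \<open>In the theorem, the type of \<open>G'\<close> is not tied to \<open>'k\<close>: its coefficients come from an arbitrary
  commutative ring. When \<open>2 \<noteq> 0\<close> there, the clause on proper subsets holds for another reason:
  none of the relations lies in the kernel, although the kernel is not zero. This is seen by evaluating
  at \<open>x\<^sub>s = 1\<close>, \<open>y\<^sub>s = 0\<close> for one \<open>s\<close> and at \<open>x\<^sub>i = 0\<close>, \<open>y\<^sub>i = 1\<close> elsewhere.\<close>

fun test_point :: "nat \<Rightarrow> svar \<Rightarrow> (svar, 'k::comm_ring_1) mpoly" where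
  "test_point s (Sx i) = of_bool (i = s)"
| "test_point s (Sy i) = of_bool (i \<noteq> s)"

definition test_eval :: "nat \<Rightarrow> (qvar, 'k::comm_ring_1) mpoly \<Rightarrow> (svar, 'k) mpoly" where
  "test_eval s p = peval (test_point s) Const (piQ p)"

lemma test_eval_add: "test_eval s (p + q) = test_eval s p + test_eval s q"
  by (simp add: test_eval_def piQ_add peval_add)

lemma test_eval_mult: "test_eval s (p * q) = test_eval s p * test_eval s q"
  by (simp add: test_eval_def piQ_mult peval_mult)

lemma test_eval_sum: "test_eval s (\<Sum>i\<in>I. f i) = (\<Sum>i\<in>I. test_eval s (f i))"
  by (simp add: test_eval_def piQ_sum peval_sum)

lemma prod_of_bool: "finite C \<Longrightarrow> (\<Prod>i\<in>C. of_bool (P i)) = (of_bool (\<forall>i\<in>C. P i) :: 'a::comm_semiring_1)"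
  by (induction rule: finite_induct) auto

lemma test_eval_xpow: "finite C \<Longrightarrow> test_eval s (xpow C) = of_bool (\<forall>i\<in>C. i = s)"
  by (simp add: test_eval_def xpow_def pi_img_def piQ_prod peval_prod prod_of_bool)

lemma test_eval_xpow_eq_0:
  assumes "finite C" "\<not> (\<forall>i\<in>C. i = s)"
  shows "test_eval s (xpow C) = 0"
  using assms(2) by (simp only: test_eval_xpow[OF assms(1)] of_bool_eq)

lemma test_eval_Npow:
  assumes "finite C"
  shows "test_eval s (Npow C) = of_bool (s \<notin> C)"
proof -
  have "test_eval s (Npow C) = (\<Prod>i\<in>C. of_bool (i \<noteq> s))"
    unfolding test_eval_def Npow_def piQ_prod peval_prod
    by (intro prod.cong) (auto simp: pi_img_def peval_add peval_mult power2_eq_square)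
  also have "\<dots> = of_bool (s \<notin> C)"
    using assms by (auto simp: prod_of_bool)
  finally show ?thesis .
qed

text \<open>At the test point x + y equals 1 at every index, so the conjugate product is always 1
  and only the y-product notices whether \<open>s\<close> lies in \<open>C\<close>.\<close>

lemma test_eval_trS:
  assumes "finite C"
  shows "peval (test_point s) Const (trS C) = of_bool (s \<notin> C) + 1"
proof -
  have "(\<Prod>i\<in>C. of_bool (i \<noteq> s) + of_bool (i = s)) = (1 :: (svar, 'a) mpoly)"
    by (intro prod.neutral) auto
  moreover have "(\<Prod>i\<in>C. of_bool (i \<noteq> s)) = (of_bool (s \<notin> C) :: (svar, 'a) mpoly)"
    using assms by (auto simp: prod_of_bool)
  ultimately show ?thesis
    by (simp add: trS_def peval_add peval_prod)
qed

lemma test_eval_Tr: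
  assumes "finite C"
  shows "s \<in> C \<Longrightarrow> test_eval s (Tr C :: (qvar, 'k::comm_ring_1) mpoly) = 1"
    "s \<notin> C \<Longrightarrow> card C \<ge> 2 \<Longrightarrow> test_eval s (Tr C :: (qvar, 'k) mpoly) = 1 + 1"
proof -
  have trS: "test_eval s (Tr C :: (qvar, 'k) mpoly) = of_bool (s \<notin> C) + 1" if "card C \<ge> 2"
    using that by (simp add: Tr_ge2 test_eval_def pi_img_def test_eval_trS[OF assms])
  then show "test_eval s (Tr C :: (qvar, 'k) mpoly) = 1 + 1" if "s \<notin> C" "card C \<ge> 2"
    using that by simp
  show "test_eval s (Tr C :: (qvar, 'k) mpoly) = 1" if "s \<in> C"
  proof (cases "card C \<ge> 2")
    case False
    moreover have "card C \<noteq> 0"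
      using that assms by auto
    ultimately have "card C = 1"
      by linarith
    then obtain t where "C = {t}"
      by (rule card_1_singletonE)
    then have "C = {s}"
      using that by simp
    then show ?thesis
      by (simp add: test_eval_def pi_img_def)
  qed (use trS that in simp)
qed

lemma psubset_Diff_singletonD:
  assumes "L \<subset> A" "\<forall>i\<in>A - L. i = s"
  shows "s \<in> A" "L = A - {s}"
  using assms by auto

text \<open>The test point kills every product of x involving an index other than \<open>s\<close>.
  This leaves \<open>L = A - {s}\<close>, whose trace avoids \<open>s\<close> and has value
  2.\<close>

lemma test_eval_rho:
  assumes A: "A \<in> subsets_ge m 3" and s: "s \<in> A"
  shows "test_eval s (rho A :: (qvar, 'k::comm_ring_1) mpoly) = 1 + 1"
proof -
  let ?e = "test_eval s :: (qvar, 'k) mpoly \<Rightarrow> (svar, 'k) mpoly"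
  let ?X = "{L. L \<subset> A \<and> L \<noteq> {}}"
  have fin: "finite A"
    using card_subsets_ge[OF A] by blast
  have card: "card (A - {s}) \<ge> 2"
    using card_subsets_ge[OF A] s by (simp add: card_Diff_singleton)
  have "finite ?X"
    by (rule finite_subset[of _ "Pow A"]) (use fin in auto)
  moreover have "A - {s} \<noteq> {}"
    using card by (intro notI) (simp only: card.empty)
  then have "A - {s} \<in> ?X"
    using s by blast
  ultimately have "(\<Sum>L\<in>?X. ?e (xpow (A - L)) * ?e (Tr L))
      = ?e (xpow (A - (A - {s}))) * ?e (Tr (A - {s}))
      + (\<Sum>L\<in>?X - {A - {s}}. ?e (xpow (A - L)) * ?e (Tr L))"
    by (rule sum.remove)
  also have "(\<Sum>L\<in>?X - {A - {s}}. ?e (xpow (A - L)) * ?e (Tr L)) = 0"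
  proof (intro sum.neutral ballI)
    fix L assume "L \<in> ?X - {A - {s}}"
    then have "\<not> (\<forall>i\<in>A - L. i = s)"
      using psubset_Diff_singletonD(2)[of L A s] by blast
    then show "?e (xpow (A - L)) * ?e (Tr L) = 0"
      using fin by (simp add: test_eval_xpow_eq_0)
  qed
  also have "?e (xpow (A - (A - {s}))) = 1"
    using fin by (simp add: test_eval_xpow)
  also have "?e (Tr (A - {s})) = 1 + 1"
    using fin card by (intro test_eval_Tr) auto
  finally show ?thesis
    by (simp add: rho_def test_eval_sum test_eval_mult)
qed

text \<open>With \<open>s\<close> in the second set the sum over subsets of \<open>J\<close> dies,
  since \<open>s\<close> is not in \<open>J\<close>. If \<open>s\<close> lies in both sets, the
  product of traces and the term \<open>L = I - {s}\<close> contribute 1 each; otherwise the trace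
  of \<open>A\<close> has value 2, that of \<open>B\<close> has value 1, and the sum over subsets of
  \<open>I\<close> dies as well.\<close>

lemma test_eval_typeII:
  assumes A: "A \<in> subsets_ge m 2" and B: "B \<in> subsets_ge m 2" and s: "s \<in> B"
  shows "test_eval s (typeII A B :: (qvar, 'k::comm_ring_1) mpoly) = 1 + 1"
proof -
  let ?e = "test_eval s :: (qvar, 'k) mpoly \<Rightarrow> (svar, 'k) mpoly"
  define I J K where "I = A \<inter> B" and "J = A - B" and "K = B - A"
  have fin: "finite I" "finite J" "finite K" "finite A" "finite B"
    using card_subsets_ge[OF A] card_subsets_ge[OF B] by (auto simp: I_def J_def K_def)
  let ?f = "\<lambda>L. ?e (xpow (I - L)) * ?e (Npow L) * ?e (Tr ((I - L) \<union> J \<union> K))"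
  have J: "(\<Sum>L\<in>{L. L \<subset> J}. ?e (xpow (J - L)) * ?e (Tr (L \<union> K))) = 0"
  proof (intro sum.neutral ballI)
    fix L assume "L \<in> {L. L \<subset> J}"
    moreover have "s \<notin> J"
      using s by (simp add: J_def)
    ultimately have "\<not> (\<forall>i\<in>J - L. i = s)"
      using psubset_Diff_singletonD(1)[of L J s] by blast
    then show "?e (xpow (J - L)) * ?e (Tr (L \<union> K)) = 0"
      using fin by (simp add: test_eval_xpow_eq_0)
  qed
  have other: "?f L = 0" if "L \<subset> I" "L \<noteq> I - {s}" for L
  proof -
    have "\<not> (\<forall>i\<in>I - L. i = s)"
      using that psubset_Diff_singletonD(2)[of L I s] by blast
    then show ?thesis
      using fin by (simp add: test_eval_xpow_eq_0)
  qed
  have TrB: "?e (Tr B) = 1"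
    using fin s by (intro test_eval_Tr)
  have "?e (Tr A) + (\<Sum>L\<in>{L. L \<subset> I}. ?f L) = 1 + 1"
  proof (cases "s \<in> A")
    case True
    then have "s \<in> I"
      using s by (simp add: I_def)
    have "finite {L. L \<subset> I}"
      by (rule finite_subset[of _ "Pow I"]) (use fin in auto)
    moreover have "I - {s} \<in> {L. L \<subset> I}"
      using \<open>s \<in> I\<close> by blast
    ultimately have "(\<Sum>L\<in>{L. L \<subset> I}. ?f L) = ?f (I - {s}) + (\<Sum>L\<in>{L. L \<subset> I} - {I - {s}}. ?f L)"
      by (rule sum.remove)
    also have "(\<Sum>L\<in>{L. L \<subset> I} - {I - {s}}. ?f L) = 0"
      using other by (intro sum.neutral) blast
    also have "I - (I - {s}) = {s}"
      using \<open>s \<in> I\<close> by blast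
    also have "?e (Tr ({s} \<union> J \<union> K)) = 1"
      using fin by (intro test_eval_Tr) auto
    finally have "(\<Sum>L\<in>{L. L \<subset> I}. ?f L) = 1"
      using fin by (simp add: test_eval_xpow test_eval_Npow)
    moreover have "?e (Tr A) = 1"
      using fin True by (intro test_eval_Tr)
    ultimately show ?thesis
      by simp
  next
    case False
    then have "I - {s} = I"
      by (auto simp: I_def)
    then have "(\<Sum>L\<in>{L. L \<subset> I}. ?f L) = 0"
      using other by (intro sum.neutral) blast
    moreover have "?e (Tr A) = 1 + 1"
      using fin False card_subsets_ge(3)[OF A] by (intro test_eval_Tr)
    ultimately show ?thesis
      by simp
  qed
  moreover have "?e (typeII A B) = ?e (Tr A) + (\<Sum>L\<in>{L. L \<subset> I}. ?f L)"
    unfolding typeII_def Let_def I_def[symmetric] J_def[symmetric] K_def[symmetric]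
    by (simp only: test_eval_add test_eval_mult test_eval_sum J TrB mult_1_right mult_zero_right add_0_right)
  ultimately show ?thesis
    by simp
qed

lemma rel_notin_kerPi:
  fixes g :: "(qvar, 'k::comm_ring_1) mpoly"
  assumes "(1 + 1 :: 'k) \<noteq> 0" "ordering_choice m ch" "g \<in> typeI_rels m \<union> typeII_rels m ch"
  shows "g \<notin> kerPi m"
proof
  assume ker: "g \<in> kerPi m"
  have "\<exists>s. test_eval s g = 1 + 1"
  proof (cases "g \<in> typeI_rels m")
    case True
    then obtain A where A: "A \<in> subsets_ge m 3" "g = rho A"
      by (auto simp: typeI_rels_def)
    then obtain s where "s \<in> A"
      using card_subsets_ge(3)[OF A(1)] by fastforce
    then show ?thesis
      using test_eval_rho A by blast
  next
    case False
    then obtain A B where AB: "A \<in> subsets_ge m 2" "B \<in> subsets_ge m 2" "g = typeII A B"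
      using assms by (auto elim: typeII_relsE)
    then obtain s where "s \<in> B"
      using card_subsets_ge(3)[OF AB(2)] by fastforce
    then show ?thesis
      using test_eval_typeII AB by blast
  qed
  then obtain s where "test_eval s g = 1 + 1"
    by blast
  then have "1 + 1 = (0 :: (svar, 'k) mpoly)"
    using ker by (simp add: test_eval_def kerPi_def)
  from arg_cong[OF this, of "\<lambda>p. lookup p 0"] show False
    using assms(1) by (simp only: lookup_add lookup_one_zero lookup_zero)
qed

lemma kerPi_nonzero:
  assumes "m \<ge> 2"
  shows "\<exists>p\<in>kerPi m. p \<noteq> (0 :: (qvar, 'k::comm_ring_1) mpoly)"
proof -
  let ?T = "Var (QT {0, 1}) :: (qvar, 'k) mpoly"
  let ?x0 = "Var (Qx 0) :: (qvar, 'k) mpoly"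
  let ?x1 = "Var (Qx 1) :: (qvar, 'k) mpoly"
  let ?N0 = "Var (QN 0) :: (qvar, 'k) mpoly"
  let ?N1 = "Var (QN 1) :: (qvar, 'k) mpoly"
  \<comment> \<open>An integral lift of the relation \<open>typeII {0, 1} {0, 1}\<close>. Write t
    for the trace, t' for the sum of the two mixed products, and N0, N1 for the norms. Then x0 x1 =
    t - t', so t^2 - x0 x1 t = t t', and t t' equals x0^2 N1 + x1^2 N0 + 4 N0 N1. The doubled terms
    express the factor 4.\<close>
  define q where "q = ?x0 * ?x1 * ?T + ?x0 * ?x0 * ?N1 + ?x1 * ?x1 * ?N0
    + (?N0 * ?N1 + ?N0 * ?N1) + (?N0 * ?N1 + ?N0 * ?N1)"
  define p where "p = ?T * ?T + (- 1) * q"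
  have vars: "QT {0, 1} \<in> qvars m" "Qx 0 \<in> qvars m" "Qx 1 \<in> qvars m" "QN 0 \<in> qvars m" "QN 1 \<in> qvars m"
    using assms by (auto simp: qvars_def subsets_ge_def)
  have "- 1 \<in> (Qring m :: (qvar, 'k) mpoly set)"
    by (auto simp: Qring_def in_keys_iff lookup_one when_def split: if_splits)
  then have "p \<in> Qring m"
    unfolding p_def q_def by (intro Qring_add Qring_mult Qring_Var vars)
  moreover have "piQ q = piQ (?T * ?T)"
    unfolding q_def piQ_add piQ_mult piQ_Var
    by (simp add: pi_img_def trS_def power2_eq_square) (simp add: algebra_simps)
  then have "piQ p = 0"
    by (simp add: p_def piQ_diff)
  moreover have "p \<noteq> 0"
  proof
    assume "p = 0"
    \<comment> \<open>Setting the trace variable to 1 and all others to 0 isolates the square of the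
      trace.\<close>
    let ?e = "peval (\<lambda>v. of_bool (v = QT {0, 1}) :: (svar, 'k) mpoly) Const"
    have "?e p = 1"
      by (simp add: p_def q_def peval_diff peval_uminus peval_add peval_mult)
    then show False
      using \<open>p = 0\<close> by simp
  qed
  ultimately show ?thesis
    by (auto simp: kerPi_def)
qed

lemma gen_ideal_psubset_neq_kerPi:
  fixes G' :: "(qvar, 'k::comm_ring_1) mpoly set"
  assumes ch: "ordering_choice m ch" and G': "G' \<subset> typeI_rels m \<union> typeII_rels m ch"
  shows "gen_ideal (Qring m) G' \<noteq> kerPi m"
proof (cases "(1 + 1 :: 'k) = 0")
  case True
  then have "CHAR('k) dvd 2"
    by (simp flip: of_nat_eq_0_iff_char_dvd)
  moreover have "CHAR('k) \<noteq> 1"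
    using of_nat_CHAR[where 'a = 'k] by (intro notI) simp
  moreover have "CHAR('k) \<noteq> 0" "CHAR('k) \<le> 2"
    using \<open>CHAR('k) dvd 2\<close> by (auto dest: dvd_imp_le intro!: gr0I)
  ultimately have char2: "CHAR('k) = 2"
    by linarith
  obtain g where g: "g \<in> typeI_rels m \<union> typeII_rels m ch" "g \<notin> G'"
    using G' by blast
  then have "g \<notin> gen_ideal (Qring m) G'"
    using G' by (intro rel_notin_gen_ideal[OF ch]) auto
  moreover have "g \<in> kerPi m"
    using g rels_subset_kerPi[OF char2 ch] by blast
  ultimately show ?thesis
    by blast
next
  case False
  \<comment> \<open>A proper subset exists only if there is some relation; this forces two indices,
    as the witness of a nonzero kernel element requires.\<close>
  obtain g :: "(qvar, 'k) mpoly" where g: "g \<in> typeI_rels m \<union> typeII_rels m ch"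
    using G' by blast
  then have "subsets_ge m 2 \<noteq> {}"
    by (auto simp: typeI_rels_def typeII_rels_def subsets_ge_def)
  then obtain A where "A \<in> subsets_ge m 2"
    by blast
  then have "m \<ge> 2"
    using card_subsets_ge[of A m 2] card_mono[of "{..<m}" A] by simp
  show ?thesis
  proof
    assume eq: "gen_ideal (Qring m) G' = kerPi m"
    have "g \<notin> G'" for g
    proof
      assume "g \<in> G'"
      then have "g \<in> kerPi m"
        using eq gen_ideal_gen by blast
      then show False
        using rel_notin_kerPi[OF False ch] G' \<open>g \<in> G'\<close> by blast
    qed
    then have "G' = {}"
      by blast
    then have "gen_ideal (Qring m) G' \<subseteq> {0}"
      by (auto simp: gen_ideal_def)
    then show False
      using kerPi_nonzero[OF \<open>m \<ge> 2\<close>, where 'k = 'k] eq by blast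
  qed
qed

section \<open>Counting the relations\<close>

lemma card_subsets_ge_eq: "card (subsets_ge m k) + (\<Sum>j<k. m choose j) = 2 ^ m"
proof -
  let ?small = "\<lambda>j. {A. A \<subseteq> {..<m} \<and> card A = j}"
  have fin: "finite (?small j)" for j
    by (rule finite_subset[of _ "Pow {..<m}"]) auto
  have "Pow {..<m} = subsets_ge m k \<union> (\<Union>j\<in>{..<k}. ?small j)"
    by (auto simp: subsets_ge_def)
  moreover have "card (subsets_ge m k \<union> (\<Union>j\<in>{..<k}. ?small j)) = card (subsets_ge m k) + card (\<Union>j\<in>{..<k}. ?small j)"
    using fin by (intro card_Un_disjoint) (auto simp: subsets_ge_def)
  moreover have "card (\<Union>j\<in>{..<k}. ?small j) = (\<Sum>j<k. card (?small j))"
    using fin by (intro card_UN_disjoint) auto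
  moreover have "card (?small j) = m choose j" for j
    using n_subsets[of "{..<m}" j] by simp
  ultimately show ?thesis
    using card_Pow[of "{..<m}"] by simp
qed

lemma card_subsets_ge_2: "card (subsets_ge m 2) = 2 ^ m - m - 1"
  using card_subsets_ge_eq[of m 2] by (simp add: numeral_2_eq_2)

lemma card_typeI_rels:
  "card (typeI_rels m :: (qvar, 'k::comm_ring_1) mpoly set) = 2 ^ m - (m choose 2) - m - 1"
proof -
  have "inj_on (rho :: _ \<Rightarrow> (qvar, 'k) mpoly) (subsets_ge m 3)"
  proof (rule inj_onI)
    fix A A' assume A: "A \<in> subsets_ge m 3" "A' \<in> subsets_ge m 3" "rho A = (rho A' :: (qvar, 'k) mpoly)"
    obtain s where s: "s \<in> A"
      using card_subsets_ge(3)[OF A(1)] by fastforce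
    show "A = A'"
      using lookup_rho_x_Tr[OF A(1) s A(2), where 'k = 'k] lookup_rho_x_Tr[OF A(1) s A(1), where 'k = 'k] A(3)
      by (auto split: if_splits)
  qed
  then have "card (typeI_rels m :: (qvar, 'k) mpoly set) = card (subsets_ge m 3)"
    unfolding typeI_rels_def by (rule card_image)
  moreover have "(\<Sum>j<3. m choose j) = 1 + m + (m choose 2)"
    by (simp add: numeral_3_eq_3 numeral_2_eq_2)
  ultimately show ?thesis
    using card_subsets_ge_eq[of m 3] by simp
qed

lemma card_typeII_rels:
  assumes ch: "ordering_choice m ch"
  shows "card (typeII_rels m ch :: (qvar, 'k::comm_ring_1) mpoly set) = (2 ^ m - m) choose 2"
proof -
  let ?T = "subsets_ge m 2"
  define D where "D = {(A, B). A \<in> ?T \<and> B \<in> ?T \<and> ch A B = (A, B)}"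
  have rels: "typeII_rels m ch = (case_prod typeII ` D :: (qvar, 'k) mpoly set)"
  proof
    show "typeII_rels m ch \<subseteq> (case_prod typeII ` D :: (qvar, 'k) mpoly set)"
      by (auto simp: D_def elim!: typeII_relsE[OF ch])
    show "(case_prod typeII ` D :: (qvar, 'k) mpoly set) \<subseteq> typeII_rels m ch"
      unfolding D_def typeII_rels_def by (force)
  qed
  have inj_pair: "inj_on (\<lambda>(A, B). {A, B}) D"
  proof (rule inj_onI)
    fix p q assume p: "p \<in> D" and q: "q \<in> D" and eq: "(case p of (A, B) \<Rightarrow> {A, B}) = (case q of (A, B) \<Rightarrow> {A, B})"
    obtain A B A' B' where "p = (A, B)" "q = (A', B')"
      by (cases p, cases q)
    then show "p = q"
      using typeII_pair_unique[OF ch, of A B A' B'] p q eq by (simp add: D_def)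
  qed
  have "inj_on (case_prod typeII :: _ \<Rightarrow> (qvar, 'k) mpoly) D"
  proof (rule inj_onI)
    fix p q assume p: "p \<in> D" and q: "q \<in> D" and eq: "case_prod typeII p = (case_prod typeII q :: (qvar, 'k) mpoly)"
    obtain A B A' B' where pq: "p = (A, B)" "q = (A', B')"
      by (cases p, cases q)
    have AB: "A \<in> ?T" "B \<in> ?T" "A' \<in> ?T" "B' \<in> ?T"
      using p q by (simp_all add: pq D_def)
    have "Tr_Tr_mon A' B' = Tr_Tr_mon A B"
      using lookup_typeII_Tr_Tr[OF AB(1,2), of A B, where 'k = 'k]
        lookup_typeII_Tr_Tr[OF AB(3,4), of A B, where 'k = 'k] eq
      by (simp add: pq split: if_splits)
    then have "{A, B} = {A', B'}"
      by (rule Tr_Tr_mon_eqD[OF sym])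
    then have "(case p of (A, B) \<Rightarrow> {A, B}) = (case q of (A, B) \<Rightarrow> {A, B})"
      by (simp only: pq prod.case)
    then show "p = q"
      by (rule inj_onD[OF inj_pair _ p q])
  qed
  then have "card (typeII_rels m ch :: (qvar, 'k) mpoly set) = card D"
    unfolding rels by (rule card_image)
  also have "\<dots> = card ((\<lambda>(A, B). {A, B}) ` D)"
    using inj_pair by (rule card_image[symmetric])
  \<comment> \<open>The square of a trace corresponds to a singleton, so unordered pairs with
    repetition are the sets of one or two elements; n + (n choose 2) = (n + 1 choose 2) then gives
    the count.\<close>
  also have "(\<lambda>(A, B). {A, B}) ` D = {X. X \<subseteq> ?T \<and> card X = 1} \<union> {X. X \<subseteq> ?T \<and> card X = 2}"
  proof (intro equalityI subsetI)
    fix X assume "X \<in> (\<lambda>(A, B). {A, B}) ` D"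
    then obtain p where "p \<in> D" and X: "X = (case p of (A, B) \<Rightarrow> {A, B})"
      by (rule imageE)
    obtain A B where p: "p = (A, B)"
      by (cases p)
    have "X \<subseteq> ?T"
      using \<open>p \<in> D\<close> unfolding X p D_def by simp
    moreover have "card X = 1 \<or> card X = 2"
      unfolding X p by (cases "A = B") simp_all
    ultimately show "X \<in> {X. X \<subseteq> ?T \<and> card X = 1} \<union> {X. X \<subseteq> ?T \<and> card X = 2}"
      by blast
  next
    fix X assume "X \<in> {X. X \<subseteq> ?T \<and> card X = 1} \<union> {X. X \<subseteq> ?T \<and> card X = 2}"
    then obtain A B where AB: "X = {A, B}" "A \<in> ?T" "B \<in> ?T"
      by (auto simp: card_1_singleton_iff card_2_iff)
    then have "ch A B = (A, B) \<or> ch B A = (B, A)"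
      using ch by (metis ordering_choice_def)
    then show "X \<in> (\<lambda>(A, B). {A, B}) ` D"
      using AB unfolding D_def by (force simp: insert_commute)
  qed
  also have "card \<dots> = card {X. X \<subseteq> ?T \<and> card X = 1} + card {X. X \<subseteq> ?T \<and> card X = 2}"
    by (intro card_Un_disjoint) (auto intro: finite_subset[of _ "Pow ?T"])
  also have "\<dots> = (card ?T choose 1) + (card ?T choose 2)"
    by (simp only: n_subsets[OF finite_subsets_ge])
  also have "\<dots> = Suc (card ?T) choose 2"
    by (simp add: numeral_2_eq_2)
  also have "Suc (card ?T) = 2 ^ m - m"
  proof -
    \<comment> \<open>This keeps the truncated subtraction exact, so that the successor cancels the
      final 1.\<close>
    have "m < (2::nat) ^ m"
      by (rule less_exp)
    then show ?thesis
      unfolding card_subsets_ge_2 by linarith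
  qed
  finally show ?thesis .
qed

theorem mainTheorem4:
  fixes m :: nat and ch :: "nat set \<Rightarrow> nat set \<Rightarrow> nat set \<times> nat set"
  assumes "CHAR('k::field) = 2"
    and "m \<ge> 1"
    and "ordering_choice m ch"
  shows "gen_ideal (Qring m) (typeI_rels m \<union> typeII_rels m ch) = (kerPi m :: (qvar, 'k) mpoly set)
    \<and> (\<forall>G'. G' \<subset> typeI_rels m \<union> typeII_rels m ch \<longrightarrow> gen_ideal (Qring m) G' \<noteq> kerPi m)
    \<and> card (typeI_rels m :: (qvar, 'k) mpoly set) = 2 ^ m - (m choose 2) - m - 1
    \<and> card (typeII_rels m ch :: (qvar, 'k) mpoly set) = (2 ^ m - m) choose 2
    \<and> typeI_rels m \<inter> typeII_rels m ch = {}"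
proof (intro conjI allI impI)
  show "gen_ideal (Qring m) (typeI_rels m \<union> typeII_rels m ch) = (kerPi m :: (qvar, 'k) mpoly set)"
    using assms(1,3) by (rule gen_ideal_eq_kerPi)
qed (use assms(3) in \<open>simp_all only: gen_ideal_psubset_neq_kerPi card_typeI_rels card_typeII_rels
    typeI_typeII_disjoint not_False_eq_True\<close>)

end
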